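(* Let $\mathfrak{g}$ be the real Lie algebra $\mathfrak{sl}_3(\mathbf{C})$ and let $\mathfrak{g}\to\mathrm{End}(W)$ be a faithful finite dimensional real representation such that there is a symmetric bilinear $\mathfrak{g}$-equivariant map $\wedge:W\times W\to W^*$ which does not vanish identically on any $2$-dimensional linear subspace of $W$. Then, after composing the representation with an automorphism of $\mathfrak{g}$, there exist integers $k,l,m\geq 0$ such that $$W\simeq \mathrm{Her}(E_{\mathbf{C}}^* )\oplus E_{\mathbf{C}}^k\oplus \overline{E_{\mathbf{C}}}^{\,l}\oplus T^m$$ as real representations of $\mathfrak{g}$.
   Context: $E_{\mathbf{C}}=\mathbf{C}^3$ with its standard action of $\mathfrak{sl}_3(\mathbf{C})$ (viewed as a real representation), $\overline{E_{\mathbf{C}}}$ its complex conjugate representation, $\mathrm{Her}(E_{\mathbf{C}}^* )$ the real representation on hermitian forms on $\mathbf{C}^3$, $T$ the trivial one-dimensional real representation, and $V^k$ the direct sum of $k$ copies of $V$. Equivariance of $\wedge$ means $X\cdot(a\wedge b)=(X\cdot a)\wedge b+a\wedge(X\cdot b)$. *)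

theory Defs
  imports "HOL-Analysis.Analysis"
begin

definition sl3 :: "(complex^3^3) set" where
  "sl3 = {X. trace X = 0}"

definition lie_bracket :: "complex^3^3 \<Rightarrow> complex^3^3 \<Rightarrow> complex^3^3" where
  "lie_bracket X Y = X ** Y - Y ** X"

definition conj_mat :: "complex^3^3 \<Rightarrow> complex^3^3" where
  "conj_mat X = (\<chi> i j. cnj (X $ i $ j))"

definition adj_mat :: "complex^3^3 \<Rightarrow> complex^3^3" where
  "adj_mat X = (\<chi> i j. cnj (X $ j $ i))"

text \<open>Hermitian forms on C^3, h(u,v) = u^* H v, represented by hermitian matrices H.\<close>
definition hermitian :: "complex^3^3 \<Rightarrow> bool" where
  "hermitian H \<longleftrightarrow> adj_mat H = H"

text \<open>Action of sl_3(C) on Her(E^*): (X.h)(u,v) = - h(Xu,v) - h(u,Xv), i.e. H |-> -(X^* H + H X).\<close>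
definition her_action :: "complex^3^3 \<Rightarrow> complex^3^3 \<Rightarrow> complex^3^3" where
  "her_action X H = - (adj_mat X ** H + H ** X)"

definition is_real_rep :: "(complex^3^3 \<Rightarrow> 'w::real_vector \<Rightarrow> 'w) \<Rightarrow> bool" where
  "is_real_rep \<rho> \<longleftrightarrow>
     (\<forall>X\<in>sl3. linear (\<rho> X)) \<and>
     (\<forall>X\<in>sl3. \<forall>Y\<in>sl3. \<forall>w. \<rho> (X + Y) w = \<rho> X w + \<rho> Y w) \<and>
     (\<forall>X\<in>sl3. \<forall>r::real. \<forall>w. \<rho> (r *\<^sub>R X) w = r *\<^sub>R \<rho> X w) \<and>
     (\<forall>X\<in>sl3. \<forall>Y\<in>sl3. \<forall>w. \<rho> (lie_bracket X Y) w = \<rho> X (\<rho> Y w) - \<rho> Y (\<rho> X w))"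

definition is_lie_aut :: "(complex^3^3 \<Rightarrow> complex^3^3) \<Rightarrow> bool" where
  "is_lie_aut \<phi> \<longleftrightarrow>
     bij_betw \<phi> sl3 sl3 \<and>
     (\<forall>X\<in>sl3. \<forall>Y\<in>sl3. \<phi> (X + Y) = \<phi> X + \<phi> Y) \<and>
     (\<forall>X\<in>sl3. \<forall>r::real. \<phi> (r *\<^sub>R X) = r *\<^sub>R \<phi> X) \<and>
     (\<forall>X\<in>sl3. \<forall>Y\<in>sl3. \<phi> (lie_bracket X Y) = lie_bracket (\<phi> X) (\<phi> Y))"

text \<open>Carrier of the model Her(E^*) + E^k + conj(E)^l + T^m: a hermitian matrix, k vectors of C^3,
  l vectors of C^3, and m real numbers (all entries beyond the indicated range are 0).\<close>
definition model ::
  "nat \<Rightarrow> nat \<Rightarrow> nat \<Rightarrow> ((complex^3^3) \<times> (nat \<Rightarrow> complex^3) \<times> (nat \<Rightarrow> complex^3) \<times> (nat \<Rightarrow> real)) set" where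
  "model k l m = {(H, u, v, c). hermitian H \<and> (\<forall>i\<ge>k. u i = 0) \<and> (\<forall>i\<ge>l. v i = 0) \<and> (\<forall>i\<ge>m. c i = 0)}"

text \<open>W is isomorphic, as a real representation of sl_3(C) via \<rho>, to
  Her(E^*) + E^k + conj(E)^l + T^m: there are real-linear equivariant maps from each summand into W
  whose sum is a bijection from the model onto W.  E acts by X.u = X u; the complex conjugate
  representation conj(E) is realised on C^3 by X.v = conj(X) v; T is trivial.\<close>
definition rep_iso_model :: "(complex^3^3 \<Rightarrow> 'w::real_vector \<Rightarrow> 'w) \<Rightarrow> nat \<Rightarrow> nat \<Rightarrow> nat \<Rightarrow> bool" where
  "rep_iso_model \<rho> k l m \<longleftrightarrow>
     (\<exists>(h :: complex^3^3 \<Rightarrow> 'w) (e :: nat \<Rightarrow> complex^3 \<Rightarrow> 'w) (f :: nat \<Rightarrow> complex^3 \<Rightarrow> 'w) (t :: nat \<Rightarrow> 'w).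
        linear h \<and> (\<forall>i<k. linear (e i)) \<and> (\<forall>i<l. linear (f i)) \<and>
        (\<forall>X\<in>sl3. \<forall>H. hermitian H \<longrightarrow> h (her_action X H) = \<rho> X (h H)) \<and>
        (\<forall>X\<in>sl3. \<forall>i<k. \<forall>u. e i (X *v u) = \<rho> X (e i u)) \<and>
        (\<forall>X\<in>sl3. \<forall>i<l. \<forall>v. f i (conj_mat X *v v) = \<rho> X (f i v)) \<and>
        (\<forall>X\<in>sl3. \<forall>i<m. \<rho> X (t i) = 0) \<and>
        bij_betw (\<lambda>(H, u, v, c). h H + (\<Sum>i<k. e i (u i)) + (\<Sum>i<l. f i (v i)) + (\<Sum>i<m. c i *\<^sub>R t i))
                 (model k l m) UNIV)"

end

theory Submission
  imports Defs "HOL-Computational_Algebra.Polynomial"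
begin

text \<open>
  Diagonalise the real diagonal matrices of \<open>sl\<^sub>3\<close>: their weights are integral, by the theory of
  \<open>sl\<^sub>2\<close>-triples over the reals. Equivariance makes \<open>\<wedge>\<close> send \<open>W\<^sub>\<lambda> \<times> W\<^sub>\<mu>\<close> into the dual of
  \<open>W\<^sub>-\<^sub>\<lambda>\<^sub>-\<^sub>\<mu>\<close>, so two linearly independent vectors of weights \<open>\<lambda>, \<mu>\<close> force one of \<open>-2\<lambda>\<close>,
  \<open>-\<lambda> - \<mu>\<close>, \<open>-2\<mu>\<close> to be a weight. Applied to a weight of maximal norm and its reflections, this
  shows that the maximal weights are, up to the automorphism \<open>X \<mapsto> -X\<^sup>T\<close>, the three weights
  \<open>-2\<epsilon>\<^sub>k\<close>, each of multiplicity one, and that all other weights are \<open>\<epsilon>\<^sub>k\<close> or \<open>0\<close>.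
  The lines of weight \<open>-2\<epsilon>\<^sub>k\<close> generate \<open>Her(E\<^sup>*)\<close>; its complement in the weight spaces \<open>\<epsilon>\<^sub>k\<close> is
  made of copies of \<open>E\<close>, one for each member of a basis over the complex structure that a diagonal
  matrix induces on the space of weight \<open>\<epsilon>\<^sub>i\<close>; the weight \<open>0\<close> space is trivial. Entrywise
  conjugation identifies \<open>E\<close> and its conjugate as real representations, so \<open>l = 0\<close> suffices.
\<close>

section \<open>Polynomials in an operator\<close>

text \<open>Weights refer only to the real diagonal matrices, because over the reals an imaginary
  diagonal matrix need not have eigenvectors. Hence every root space is a real plane, spanned by
  \<open>mat_unit i j 1\<close> and \<open>mat_unit i j \<i>\<close>, both of which shift weights in
  the same way. This shapes the rest. The plane yields two independent vectors of one weight, which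
  fixes the size of the maximal weights. On a maximal weight space, a real line, the imaginary torus
  can act only by real scalars, and these are shown to vanish; that is the rigidity behind Her.
  Complete reducibility is never invoked: semisimplicity of the torus comes from the Casimir
  operator of \<open>sl2\<close>, and the complement of Her is cut out as a kernel. Faithfulness
  enters by producing one nonzero weight.\<close>

definition opoly :: "('a::real_vector \<Rightarrow> 'a) \<Rightarrow> real poly \<Rightarrow> 'a \<Rightarrow> 'a" where
  "opoly T p v = fold_coeffs (\<lambda>a x. a *\<^sub>R v + T x) p 0"

lemma opoly_0 [simp]: "opoly T 0 v = 0"
  by (simp add: opoly_def)

lemma opoly_pCons:
  assumes "linear T"
  shows "opoly T (pCons a p) v = a *\<^sub>R v + T (opoly T p v)"
  using linear_0[OF assms] by (cases "pCons a p = 0") (auto simp: opoly_def fold_coeffs_pCons_eq)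

lemma opoly_1 [simp]: "linear T \<Longrightarrow> opoly T 1 v = v"
  by (simp add: one_pCons opoly_pCons linear_0)

lemma opoly_linear_factor: "linear T \<Longrightarrow> opoly T [:- a, 1:] v = T v - a *\<^sub>R v"
  by (simp add: opoly_pCons linear_0)

lemma opoly_add: "linear T \<Longrightarrow> opoly T (p + q) v = opoly T p v + opoly T q v"
  by (induction p q rule: poly_induct2) (auto simp: opoly_pCons linear_add algebra_simps)

lemma opoly_smult: "linear T \<Longrightarrow> opoly T (smult c p) v = c *\<^sub>R opoly T p v"
  by (induction p) (auto simp: opoly_pCons linear_scale algebra_simps)

lemma opoly_minus: "linear T \<Longrightarrow> opoly T (- p) v = - opoly T p v"
  using opoly_smult[of T "-1" p v] by simp

lemma opoly_diff: "linear T \<Longrightarrow> opoly T (p - q) v = opoly T p v - opoly T q v"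
  using opoly_add[of T p "- q" v] by (simp add: opoly_minus)

lemma opoly_sum: "linear T \<Longrightarrow> opoly T (sum f A) v = (\<Sum>i\<in>A. opoly T (f i) v)"
  by (induction A rule: infinite_finite_induct) (auto simp: opoly_add)

lemma linear_opoly:
  assumes "linear T" shows "linear (opoly T p)"
proof (induction p)
  case 0
  show ?case by (simp add: linear_iff)
next
  case (pCons a p)
  show ?case
    using assms pCons.IH by (simp add: linear_iff opoly_pCons algebra_simps)
qed

lemma opoly_mult: "linear T \<Longrightarrow> opoly T (p * q) v = opoly T p (opoly T q v)"
  by (induction p) (auto simp: opoly_pCons opoly_add opoly_smult)

lemma opoly_monom: "linear T \<Longrightarrow> opoly T (monom c n) v = c *\<^sub>R (T ^^ n) v"
  by (induction n) (auto simp: opoly_pCons monom_0 monom_Suc linear_0 linear_scale)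

lemma opoly_eigenvector:
  "linear T \<Longrightarrow> T v = l *\<^sub>R v \<Longrightarrow> opoly T p v = poly p l *\<^sub>R v"
  by (induction p) (auto simp: opoly_pCons linear_scale algebra_simps)

text \<open>\<open>q(x + s)\<close> appears because \<open>T\<close> shifts by \<open>s\<close> when it is moved past \<open>E\<close>.\<close>
lemma opoly_shift:
  assumes "linear T" "linear E" "\<And>v. T (E v) = E (T v) + s *\<^sub>R E v"
  shows "opoly T q (E v) = E (opoly T (q \<circ>\<^sub>p [:s, 1:]) v)"
proof (induction q)
  case 0
  show ?case using assms by (simp add: linear_0)
next
  case (pCons a q)
  have "opoly T (pCons a q) (E v) = a *\<^sub>R E v + T (E (opoly T (q \<circ>\<^sub>p [:s, 1:]) v))"
    by (simp add: opoly_pCons assms(1) pCons.IH)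
  also have "\<dots> = E (opoly T (pCons a q \<circ>\<^sub>p [:s, 1:]) v)"
    using assms by (simp add: pcompose_pCons opoly_add opoly_mult opoly_smult opoly_pCons linear_add
        linear_scale linear_0 algebra_simps)
  finally show ?case .
qed

text \<open>Families rather than sets, because the powers \<open>(T ^^ i) v\<close> may repeat; a
  repetition at i and j gives the coefficients 1 and -1.\<close>

lemma finite_family_dependent:
  fixes x :: "nat \<Rightarrow> 'a::euclidean_space"
  shows "\<exists>c. (\<exists>i\<le>DIM('a). c i \<noteq> 0) \<and> (\<Sum>i\<le>DIM('a). c i *\<^sub>R x i) = 0"
proof (cases "inj_on x {..DIM('a)}")
  case True
  have "card (x ` {..DIM('a)}) > DIM('a)"
    by (simp add: card_image[OF True])
  then have "dependent (x ` {..DIM('a)})"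
    by (intro dependent_biggerset) auto
  then obtain u where u: "\<exists>v\<in>x ` {..DIM('a)}. u v \<noteq> 0"
      "(\<Sum>v\<in>x ` {..DIM('a)}. u v *\<^sub>R v) = 0"
    by (auto simp: dependent_finite)
  have "(\<Sum>i\<le>DIM('a). u (x i) *\<^sub>R x i) = 0"
    using u(2) by (simp add: sum.reindex[OF True])
  with u(1) show ?thesis by (intro exI[of _ "u \<circ> x"]) auto
next
  case False
  then obtain i j where ij: "i \<le> DIM('a)" "j \<le> DIM('a)" "i \<noteq> j" "x i = x j"
    by (auto simp: inj_on_def)
  let ?c = "\<lambda>k. (if k = i then 1 else 0) - (if k = j then 1 else 0 :: real)"
  have "(\<Sum>k\<le>DIM('a). ?c k *\<^sub>R x k)
      = (\<Sum>k\<le>DIM('a). if k = i then x i else 0) - (\<Sum>k\<le>DIM('a). if k = j then x j else 0)"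
    by (subst sum_subtractf[symmetric], rule sum.cong) auto
  also have "\<dots> = 0" using ij by simp
  finally show ?thesis using ij by (intro exI[of _ ?c]) auto
qed

lemma exists_annihilating_poly_vec:
  fixes T :: "'a::euclidean_space \<Rightarrow> 'a"
  assumes "linear T"
  shows "\<exists>p. p \<noteq> 0 \<and> opoly T p v = 0"
proof -
  obtain c where c: "\<exists>i\<le>DIM('a). c i \<noteq> 0" "(\<Sum>i\<le>DIM('a). c i *\<^sub>R (T ^^ i) v) = 0"
    using finite_family_dependent[of "\<lambda>i. (T ^^ i) v"] by blast
  let ?p = "\<Sum>i\<le>DIM('a). monom (c i) i"
  from c(1) obtain i where "i \<le> DIM('a)" "c i \<noteq> 0" by blast
  then have "coeff ?p i \<noteq> 0" by (simp add: coeff_sum)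
  then have "?p \<noteq> 0" by (metis coeff_0)
  moreover have "opoly T ?p v = 0"
    using c(2) assms by (simp add: opoly_sum opoly_monom)
  ultimately show ?thesis by blast
qed

text \<open>The factors \<open>opoly T (q b)\<close> commute, so each basis vector can be met first
  by its own annihilator.\<close>

lemma exists_annihilating_poly:
  fixes T :: "'a::euclidean_space \<Rightarrow> 'a"
  assumes "linear T"
  shows "\<exists>p. p \<noteq> 0 \<and> (\<forall>v. opoly T p v = 0)"
proof -
  obtain q where q: "\<And>b. q b \<noteq> 0" "\<And>b. opoly T (q b) b = 0"
    using exists_annihilating_poly_vec[OF assms] by metis
  let ?p = "\<Prod>b\<in>Basis. q b"
  have zero: "opoly T ?p b = 0" if "b \<in> Basis" for b
  proof -
    have "?p = (\<Prod>b\<in>Basis - {b}. q b) * q b"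
      using that by (simp add: prod.remove[of Basis b] mult.commute)
    then show ?thesis
      using assms q(2) linear_0[OF linear_opoly[OF assms]] by (simp add: opoly_mult)
  qed
  have "opoly T ?p v = 0" for v
    using linear_eq_on_span[of "opoly T ?p" "\<lambda>_. 0" Basis v] zero linear_opoly[OF assms]
      module_hom_zero span_Basis by auto
  moreover have "?p \<noteq> 0" using q(1) by simp
  ultimately show ?thesis by blast
qed

text \<open>Invariance under a nonzero translation repeats the value at 0 at infinitely many
  points.\<close>

lemma degree_shift_invariant:
  fixes p :: "real poly"
  assumes "s \<noteq> 0" "p \<circ>\<^sub>p [:- s, 1:] = p"
  shows "degree p = 0"
proof -
  have shift: "poly p (x - s) = poly p x" for x
    using arg_cong[OF assms(2), of "\<lambda>q. poly q x"] by (simp add: poly_pcompose algebra_simps)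
  have "poly p (- (real n * s)) = poly p 0" for n
  proof (induction n)
    case (Suc n)
    have "- (real (Suc n) * s) = - (real n * s) - s" by (simp add: algebra_simps)
    then show ?case using Suc shift by metis
  qed simp
  then have "range (\<lambda>n. - (real n * s)) \<subseteq> {x. poly (p - [:poly p 0:]) x = 0}" by auto
  moreover have "infinite (range (\<lambda>n. - (real n * s)))"
    by (rule range_inj_infinite) (use assms(1) in \<open>auto simp: inj_on_def\<close>)
  ultimately have "p - [:poly p 0:] = 0"
    using poly_roots_finite finite_subset by blast
  then have "p = [:poly p 0:]" by simp
  then show ?thesis by (metis degree_pCons_0)
qed

text \<open>Take \<open>p \<noteq> 0\<close> of least degree with \<open>p(H) E\<^sup>k = 0\<close> for some \<open>k\<close>. Moving \<open>E\<close> across gives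
  \<open>p(H - s) E\<^sup>k\<^sup>+\<^sup>1 = 0\<close>, and \<open>p(x) - p(x - s)\<close> has smaller degree.\<close>
lemma nilpotent_of_shift:
  fixes E H :: "'a::euclidean_space \<Rightarrow> 'a"
  assumes "linear E" "linear H" "s \<noteq> 0" "\<And>v. H (E v) = E (H v) + s *\<^sub>R E v"
  shows "\<exists>n. \<forall>v. (E ^^ n) v = 0"
proof -
  define P where "P d \<longleftrightarrow> (\<exists>p k. p \<noteq> 0 \<and> degree p = d \<and> (\<forall>v. opoly H p ((E ^^ k) v) = 0))" for d
  have "\<exists>d. P d"
    using exists_annihilating_poly[OF assms(2)] unfolding P_def by blast
  then have "P (LEAST d. P d)" by (rule LeastI_ex)
  then obtain p k where p: "p \<noteq> 0" "degree p = (LEAST d. P d)" "\<And>v. opoly H p ((E ^^ k) v) = 0"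
    unfolding P_def by blast
  have "degree p = 0"
  proof (rule ccontr)
    assume deg: "degree p \<noteq> 0"
    define q where "q = p \<circ>\<^sub>p [:- s, 1:]"
    have inv: "q \<circ>\<^sub>p [:s, 1:] = p"
      unfolding q_def by (simp flip: pcompose_assoc add: pcompose_pCons pcompose_idR)
    have "opoly H q ((E ^^ Suc k) v) = 0" for v
      using opoly_shift[OF assms(2,1,4), of q "(E ^^ k) v"] p(3)[of v] linear_0[OF assms(1)]
      by (simp add: inv)
    moreover have "opoly H p ((E ^^ Suc k) v) = 0" for v
      using p(3)[of "E v"] by (simp add: funpow_swap1)
    ultimately have zero: "opoly H (p - q) ((E ^^ Suc k) v) = 0" for v
      using assms(2) by (simp add: opoly_diff)
    have nz: "p - q \<noteq> 0"
      using degree_shift_invariant[OF assms(3), of p] deg by (auto simp: q_def)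
    have "degree q = degree p" by (simp add: q_def degree_pcompose)
    moreover have "lead_coeff q = lead_coeff p" by (simp add: q_def lead_coeff_comp)
    ultimately have "degree (p - q) < degree p"
      using deg nz by (metis coeff_diff degree_diff_le degree_0 eq_iff_diff_eq_0 leading_coeff_0_iff
          nle_le order_le_less)
    moreover have "P (degree (p - q))" using zero nz unfolding P_def by blast
    ultimately show False using p(2) not_less_Least by metis
  qed
  then obtain a where a: "p = [:a:]" by (rule degree_eq_zeroE)
  have "(E ^^ k) v = 0" for v
    using p(3)[of v] p(1) assms(2) by (simp add: a opoly_pCons linear_0)
  then show ?thesis by blast
qed

text \<open>The product of the other linear factors kills every summand except \<open>x m\<close>,
  and it is nonzero at m.\<close>

lemma eigenvectors_sum_zero:
  assumes "linear T" "finite A" "\<And>l. l \<in> A \<Longrightarrow> T (x l) = l *\<^sub>R x l" "(\<Sum>l\<in>A. x l) = 0" "m \<in> A"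
  shows "x m = 0"
proof -
  let ?q = "\<Prod>l\<in>A - {m}. [:- l, 1:]"
  have "0 = opoly T ?q (\<Sum>l\<in>A. x l)"
    unfolding assms(4) using linear_0[OF linear_opoly[OF assms(1)]] by simp
  also have "\<dots> = (\<Sum>l\<in>A. poly ?q l *\<^sub>R x l)"
    unfolding linear_sum[OF linear_opoly[OF assms(1)]]
    by (rule sum.cong) (simp_all add: assms opoly_eigenvector)
  also have "\<dots> = poly ?q m *\<^sub>R x m"
    using assms(2,5) by (subst sum.remove[of A m]) (auto simp: poly_prod intro!: sum.neutral)
  finally show ?thesis using assms(2) by (auto simp: poly_prod)
qed

section \<open>Triples spanning sl2\<close>

lemma scaleR_4: "4 *\<^sub>R v = v + v + v + (v::'a::real_vector)"
  using scaleR_add_left[of 2 2 v] by (simp add: scaleR_2)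

text \<open>Each relation is oriented as a rewrite rule: H moves inward past E and F, and E inward
  past F. Words in the three operators thus reach one normal form.\<close>

locale sl2_triple =
  fixes E F H :: "'a::euclidean_space \<Rightarrow> 'a"
  assumes linear_E: "linear E" and linear_F: "linear F" and linear_H: "linear H"
    and HE: "H (E v) = E (H v) + 2 *\<^sub>R E v"
    and HF: "H (F v) = F (H v) - 2 *\<^sub>R F v"
    and EF: "E (F v) = F (E v) + H v"
begin

lemmas lin = linear_add[OF linear_E] linear_add[OF linear_F] linear_add[OF linear_H]
  linear_diff[OF linear_E] linear_diff[OF linear_F] linear_diff[OF linear_H]
  linear_scale[OF linear_E] linear_scale[OF linear_F] linear_scale[OF linear_H]
  linear_0[OF linear_E] linear_0[OF linear_F] linear_0[OF linear_H]
  linear_neg[OF linear_E] linear_neg[OF linear_F] linear_neg[OF linear_H]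

lemma F_pow_linear: "linear (F ^^ n)"
  by (induction n) (auto simp: linear_iff lin)

lemma E_pow_linear: "linear (E ^^ n)"
  by (induction n) (auto simp: linear_iff lin)

lemma E_nilpotent: "\<exists>n. \<forall>v. (E ^^ n) v = 0"
  by (rule nilpotent_of_shift[OF linear_E linear_H, of 2]) (auto simp: HE)

lemma F_nilpotent: "\<exists>n. \<forall>v. (F ^^ n) v = 0"
  by (rule nilpotent_of_shift[OF linear_F linear_H, of "-2"]) (auto simp: HF)

lemma H_F_pow: "H ((F ^^ k) v) = (F ^^ k) (H v) - (2 * real k) *\<^sub>R (F ^^ k) v"
proof (induction k)
  case (Suc k)
  show ?case
    by (simp only: funpow.simps comp_apply HF Suc.IH lin) (simp add: algebra_simps)
qed simp

lemma H_E_pow: "H ((E ^^ k) v) = (E ^^ k) (H v) + (2 * real k) *\<^sub>R (E ^^ k) v"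
proof (induction k)
  case (Suc k)
  show ?case
    by (simp only: funpow.simps comp_apply HE Suc.IH lin) (simp add: algebra_simps)
qed simp

text \<open>The classical formula for lowering strings, with \<open>H v\<close> kept in place of a
  multiple of v because H is not yet known to be diagonalisable.\<close>

lemma E_F_pow:
  assumes "E v = 0"
  shows "E ((F ^^ Suc k) v) = real (Suc k) *\<^sub>R (F ^^ k) (H v - real k *\<^sub>R v)"
proof (induction k)
  case 0
  show ?case using assms by (simp add: EF lin)
next
  case (Suc k)
  have "E ((F ^^ Suc (Suc k)) v) = F (E ((F ^^ Suc k) v)) + H ((F ^^ Suc k) v)"
    by (simp add: EF)
  also have "\<dots> = real (Suc k) *\<^sub>R (F ^^ Suc k) (H v - real k *\<^sub>R v)
      + (F ^^ Suc k) (H v) - (2 * real (Suc k)) *\<^sub>R (F ^^ Suc k) v"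
    unfolding Suc.IH H_F_pow by (simp add: lin)
  also have "\<dots> = real (Suc (Suc k)) *\<^sub>R (F ^^ Suc k) (H v - real (Suc k) *\<^sub>R v)"
    by (simp add: linear_add[OF F_pow_linear] linear_diff[OF F_pow_linear]
        linear_scale[OF F_pow_linear] lin algebra_simps
        scaleR_2)
  finally show ?case .
qed

text \<open>Falling factorial x(x-1)...(x-k+1). Its roots are the highest weights whose strings end
  within k lowerings.\<close>

definition falling :: "nat \<Rightarrow> real poly" where
  "falling k = (\<Prod>j<k. [:- real j, 1:])"

lemma E_pow_F_pow:
  assumes "E v = 0"
  shows "(E ^^ k) ((F ^^ k) v) = fact k *\<^sub>R opoly H (falling k) v"
  using assms
proof (induction k arbitrary: v)
  case 0
  then show ?case by (simp add: falling_def linear_H)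
next
  case (Suc k)
  let ?w = "H v - real k *\<^sub>R v"
  have "E ?w = 0" using Suc.prems HE[of v] by (simp add: lin)
  have "(E ^^ Suc k) ((F ^^ Suc k) v) = (E ^^ k) (E ((F ^^ Suc k) v))"
    by (simp add: funpow_swap1)
  also have "\<dots> = real (Suc k) *\<^sub>R (E ^^ k) ((F ^^ k) ?w)"
    unfolding E_F_pow[OF Suc.prems] by (simp only: linear_scale[OF E_pow_linear])
  also have "\<dots> = fact (Suc k) *\<^sub>R opoly H (falling k) ?w"
    by (simp add: Suc.IH[OF \<open>E ?w = 0\<close>])
  also have "opoly H (falling k) ?w = opoly H (falling (Suc k)) v"
    by (simp only: falling_def prod.lessThan_Suc opoly_mult[OF linear_H]
        opoly_linear_factor[OF linear_H])
  finally show ?case .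
qed

text \<open>Nilpotency of F makes \<open>(E ^^ N) ((F ^^ N) v)\<close> vanish. The resulting
  polynomial has simple roots, so on the kernel of E it gives both integrality and semisimplicity of
  H.\<close>

lemma ker_E_falling: "\<exists>N. \<forall>v. E v = 0 \<longrightarrow> opoly H (falling N) v = 0"
proof -
  obtain N where "\<And>v. (F ^^ N) v = 0" using F_nilpotent by blast
  then have "opoly H (falling N) v = 0" if "E v = 0" for v
    using E_pow_F_pow[OF that, of N] linear_0[OF E_pow_linear] by simp
  then show ?thesis by blast
qed

lemma ker_E_eigenvalue:
  assumes "E v = 0" "H v = l *\<^sub>R v" "v \<noteq> 0"
  shows "\<exists>n::nat. l = real n"
proof -
  obtain N where "opoly H (falling N) v = 0" using ker_E_falling assms(1) by blast
  then have "poly (falling N) l = 0"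
    using opoly_eigenvector[OF linear_H assms(2)] assms(3) by simp
  then show ?thesis by (auto simp: falling_def poly_prod)
qed

text \<open>Twice the usual EF + FE + H^2/2, with EF eliminated. On a singular vector of weight l
  its value is l(l + 2), strictly increasing for l >= 0.\<close>

definition casimir :: "'a \<Rightarrow> 'a" where
  "casimir v = 4 *\<^sub>R F (E v) + 2 *\<^sub>R H v + H (H v)"

lemma casimir_E: "casimir (E v) = E (casimir v)"
  by (simp add: casimir_def lin HE EF algebra_simps scaleR_2 scaleR_4)

lemma casimir_H: "casimir (H v) = H (casimir v)"
  by (simp add: casimir_def lin HE HF algebra_simps scaleR_2 scaleR_4 flip: scaleR_left_distrib)

lemma casimir_diff: "casimir (v - w) = casimir v - casimir w"
  by (simp add: casimir_def lin algebra_simps)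

lemma casimir_scale: "casimir (r *\<^sub>R v) = r *\<^sub>R casimir v"
  by (simp add: casimir_def lin algebra_simps)

lemma casimir_E_pow: "casimir ((E ^^ k) v) = (E ^^ k) (casimir v)"
  by (induction k) (auto simp: casimir_E)

lemma casimir_singular:
  "E v = 0 \<Longrightarrow> H v = l *\<^sub>R v \<Longrightarrow> casimir v = (2 * l + l\<^sup>2) *\<^sub>R v"
  by (simp add: casimir_def lin power2_eq_square algebra_simps)

text \<open>Let \<open>u = (H - l) v\<close>. The end of the chain \<open>v, E v, E\<^sup>2 v, \<dots>\<close> is a singular vector of larger
  weight than the singular vector \<open>u\<close>, so the Casimir operator separates the two.\<close>
lemma H_no_jordan_block:
  assumes "(E ^^ m) v = 0" "H (H v - l *\<^sub>R v) = l *\<^sub>R (H v - l *\<^sub>R v)"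
  shows "H v = l *\<^sub>R v"
  using assms
proof (induction m arbitrary: v l)
  case 0
  then show ?case by (simp add: lin)
next
  case (Suc m)
  define u where "u = H v - l *\<^sub>R v"
  have Hu: "H u = l *\<^sub>R u" using Suc.prems(2) by (simp add: u_def)
  have Ev: "H (E v) = (l + 2) *\<^sub>R E v"
  proof (rule Suc.IH)
    show "(E ^^ m) (E v) = 0" using Suc.prems(1) by (simp add: funpow_swap1)
    have "H (E v) - (l + 2) *\<^sub>R E v = E u"
      by (simp add: HE u_def lin algebra_simps)
    then show "H (H (E v) - (l + 2) *\<^sub>R E v) = (l + 2) *\<^sub>R (H (E v) - (l + 2) *\<^sub>R E v)"
      using Hu by (simp add: HE lin algebra_simps)
  qed
  then have Eu: "E u = 0" using HE[of v] by (simp add: u_def lin algebra_simps)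
  have "u = 0"
  proof (rule ccontr)
    assume "u \<noteq> 0"
    then obtain n :: nat where n: "l = real n" using ker_E_eigenvalue[OF Eu Hu] by blast
    show False
    proof (cases "m = 0")
      \<comment> \<open>Here v itself is singular and the chain offers no larger weight; instead,
        the simple roots of the falling factorial exclude a Jordan block.\<close>
      case True
      then have "E v = 0" using Suc.prems(1) by simp
      then obtain N where N: "opoly H (falling N) v = 0" "opoly H (falling N) u = 0"
        using ker_E_falling Eu by blast
      have "poly (falling N) l = 0"
        using N(2) \<open>u \<noteq> 0\<close> opoly_eigenvector[OF linear_H Hu] by simp
      then have "n < N" by (auto simp: falling_def poly_prod n)
      let ?q = "\<Prod>j\<in>{..<N} - {n}. [:- real j, 1:]"
      have "falling N = ?q * [:- l, 1:]"
        unfolding falling_def n using \<open>n < N\<close>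
        by (subst prod.remove[of _ n]) (auto simp: mult.commute)
      then have "opoly H ?q u = 0"
        using N(1) by (simp only: opoly_mult[OF linear_H] opoly_linear_factor[OF linear_H] u_def)
      then have "poly ?q l = 0"
        using \<open>u \<noteq> 0\<close> opoly_eigenvector[OF linear_H Hu] by simp
      then show False by (auto simp: poly_prod n)
    next
      case False
      let ?k = "l + 2 * real m"
      define c where "c = 2 * ?k + ?k\<^sup>2"
      obtain m' where m': "m = Suc m'" using False by (cases m) auto
      have "H ((E ^^ m) v) = ?k *\<^sub>R (E ^^ m) v"
        using H_E_pow[of m' "E v"] Ev
        by (simp add: m' funpow_swap1 linear_scale[OF E_pow_linear] flip: scaleR_left_distrib)
      moreover have "E ((E ^^ m) v) = 0" using Suc.prems(1) by simp
      ultimately have cas: "casimir ((E ^^ m) v) = c *\<^sub>R (E ^^ m) v"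
        using casimir_singular c_def by blast
      \<comment> \<open>Since \<open>(E ^^ m) ?w = 0\<close>, the induction hypothesis makes ?w an
        eigenvector. But (H - l) ?w is 2l + l^2 - c times u, and this factor is nonzero.\<close>
      let ?w = "casimir v - c *\<^sub>R v"
      have diff: "H ?w - l *\<^sub>R ?w = casimir u - c *\<^sub>R u"
        by (simp add: u_def lin casimir_diff casimir_scale casimir_H algebra_simps)
      have cu: "casimir u = (2 * l + l\<^sup>2) *\<^sub>R u" by (rule casimir_singular[OF Eu Hu])
      have diff': "H ?w - l *\<^sub>R ?w = (2 * l + l\<^sup>2 - c) *\<^sub>R u"
        by (simp only: diff cu scaleR_left_diff_distrib)
      have "H ?w = l *\<^sub>R ?w"
      proof (rule Suc.IH)
        show "(E ^^ m) ?w = 0"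
          using cas by (simp add: linear_diff[OF E_pow_linear] linear_scale[OF E_pow_linear] casimir_E_pow)
        show "H (H ?w - l *\<^sub>R ?w) = l *\<^sub>R (H ?w - l *\<^sub>R ?w)"
          unfolding diff' by (simp add: lin Hu)
      qed
      then have "2 * l + l\<^sup>2 = c" using diff' \<open>u \<noteq> 0\<close> by simp
      moreover have "l < ?k" "0 \<le> l" using False by (auto simp: n)
      then have "l\<^sup>2 \<le> ?k\<^sup>2" by (intro power_mono) auto
      ultimately show False using \<open>l < ?k\<close> by (simp add: c_def)
    qed
  qed
  then show ?case by (simp add: u_def)
qed

lemma H_semisimple:
  assumes "H (H v - l *\<^sub>R v) = l *\<^sub>R (H v - l *\<^sub>R v)"
  shows "H v = l *\<^sub>R v"
  using E_nilpotent H_no_jordan_block assms by blast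

text \<open>A list, not a set: roots may repeat when the polynomials for the successive kernels of
  \<open>E ^^ m\<close> are multiplied.\<close>

definition int_poly :: "int list \<Rightarrow> real poly" where
  "int_poly ns = (\<Prod>n\<leftarrow>ns. [:- real_of_int n, 1:])"

lemma int_poly_Cons: "int_poly (n # ns) = [:- real_of_int n, 1:] * int_poly ns"
  by (simp add: int_poly_def)

lemma int_poly_append: "int_poly (ns @ ms) = int_poly ns * int_poly ms"
  by (simp add: int_poly_def)

lemma int_poly_shift: "int_poly ns \<circ>\<^sub>p [:2, 1:] = int_poly (map (\<lambda>n. n - 2) ns)"
proof (induction ns)
  case Nil
  show ?case by (simp add: int_poly_def one_pCons pcompose_pCons)
next
  case (Cons n ns)
  show ?case
    by (simp only: list.map int_poly_Cons pcompose_mult Cons.IH)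
       (simp add: pcompose_pCons)
qed

text \<open>If a polynomial in H annihilates E v, its shift sends v into the kernel of E, where a
  falling factorial finishes. Repeated roots are dealt with by \<open>H_semisimple\<close>.\<close>

lemma exists_int_poly: "\<exists>ns. opoly H (int_poly ns) v = 0"
proof -
  have "(E ^^ m) v = 0 \<Longrightarrow> \<exists>ns. opoly H (int_poly ns) v = 0" for m v
  proof (induction m arbitrary: v)
    case 0
    then show ?case by (auto simp: int_poly_def linear_H intro!: exI[of _ "[]"])
  next
    case (Suc m)
    then obtain ns where "opoly H (int_poly ns) (E v) = 0"
      by (metis funpow_Suc_right comp_apply)
    then have "E (opoly H (int_poly (map (\<lambda>n. n - 2) ns)) v) = 0"
      using opoly_shift[OF linear_H linear_E HE] by (simp add: int_poly_shift)
    moreover obtain N where "\<And>w. E w = 0 \<Longrightarrow> opoly H (falling N) w = 0"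
      using ker_E_falling by blast
    moreover have "falling N = int_poly (map int [0..<N])"
      by (induction N) (auto simp: falling_def int_poly_def)
    ultimately have "opoly H (int_poly (map int [0..<N] @ map (\<lambda>n. n - 2) ns)) v = 0"
      by (simp add: int_poly_append opoly_mult linear_H)
    then show ?case by blast
  qed
  then show ?thesis using E_nilpotent by blast
qed

text \<open>The invariant subspace Z allows a second, commuting operator to be diagonalised inside
  an eigenspace of the first.\<close>

lemma H_diagonalisable:
  assumes Z: "subspace Z" "\<And>z. z \<in> Z \<Longrightarrow> H z \<in> Z" and "v \<in> Z"
  shows "v \<in> span {x \<in> Z. \<exists>n::int. H x = of_int n *\<^sub>R x}" (is "_ \<in> span ?S")
proof -
  have SZ: "span ?S \<subseteq> Z" by (rule span_minimal) (use Z in auto)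
  have "opoly H (int_poly ns) v = 0 \<Longrightarrow> v \<in> Z \<Longrightarrow> v \<in> span ?S" for ns v
  proof (induction ns arbitrary: v)
    case Nil
    then show ?case by (simp add: int_poly_def linear_H span_0)
  next
    case (Cons n ns)
    let ?D = "\<lambda>v. H v - of_int n *\<^sub>R v"
    have "opoly H (int_poly ns) (?D v) = 0"
      using Cons.prems(1) unfolding int_poly_Cons
      by (subst (asm) mult.commute)
         (simp only: opoly_mult[OF linear_H] opoly_linear_factor[OF linear_H])
    then have mem: "?D v \<in> span ?S"
      using Cons.prems(2) Z by (intro Cons.IH) (auto simp: subspace_diff subspace_scale)
    \<comment> \<open>Dividing by k - n inverts H - n on the eigenspaces with k different from n, so
      (H - n) v can be corrected by some s in the span until it is an n-eigenvector. Then v - s is a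
      generalised eigenvector, and semisimplicity applies.\<close>
    let ?Q = "{x. \<exists>s\<in>span ?S. \<exists>y. x = ?D s + y \<and> H y = of_int n *\<^sub>R y}"
    have "subspace ?Q"
    proof (rule subspaceI)
      show "0 \<in> ?Q" by (auto intro!: bexI[of _ 0] exI[of _ 0] simp: span_0 lin)
    next
      fix x x' assume "x \<in> ?Q" "x' \<in> ?Q"
      then obtain s y s' y' where "s \<in> span ?S" "x = ?D s + y" "H y = of_int n *\<^sub>R y"
        "s' \<in> span ?S" "x' = ?D s' + y'" "H y' = of_int n *\<^sub>R y'" by blast
      then show "x + x' \<in> ?Q"
        by (intro CollectI bexI[of _ "s + s'"] exI[of _ "y + y'"])
           (simp_all add: lin span_add scaleR_add_right)
    next
      fix r x assume "x \<in> ?Q"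
      then obtain s y where "s \<in> span ?S" "x = ?D s + y" "H y = of_int n *\<^sub>R y" by blast
      then show "r *\<^sub>R x \<in> ?Q"
        by (intro CollectI bexI[of _ "r *\<^sub>R s"] exI[of _ "r *\<^sub>R y"])
           (simp_all add: lin span_scale scaleR_add_right scaleR_diff_right mult.commute)
    qed
    moreover have "?S \<subseteq> ?Q"
    proof
      fix x assume x: "x \<in> ?S"
      then obtain k :: int where k: "H x = of_int k *\<^sub>R x" by blast
      show "x \<in> ?Q"
      proof (cases "k = n")
        case True
        then show ?thesis
          using k by (auto intro!: bexI[of _ 0] exI[of _ x] simp: span_0 lin)
      next
        case False
        let ?s = "(1 / (of_int k - of_int n)) *\<^sub>R x"
        have "?D ?s = ((of_int k - of_int n) / (of_int k - of_int n)) *\<^sub>R x"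
          by (simp add: lin k algebra_simps flip: scaleR_left_diff_distrib diff_divide_distrib)
        then have "x = ?D ?s + 0" using False by simp
        moreover have "?s \<in> span ?S" using x by (intro span_scale span_base)
        moreover have "H 0 = of_int n *\<^sub>R 0" by (simp add: lin)
        ultimately show ?thesis by blast
      qed
    qed
    ultimately have "span ?S \<subseteq> ?Q" by (intro span_minimal)
    with mem obtain s y where s: "s \<in> span ?S" "?D v = ?D s + y" "H y = of_int n *\<^sub>R y" by blast
    have "H (v - s) = of_int n *\<^sub>R (v - s)"
    proof (rule H_semisimple)
      have "?D (v - s) = y" using s(2) by (simp add: lin algebra_simps)
      then show "H (?D (v - s)) = of_int n *\<^sub>R ?D (v - s)" using s(3) by simp
    qed
    moreover have "v - s \<in> Z" using Cons.prems(2) SZ s(1) Z(1) by (auto intro: subspace_diff)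
    ultimately have "v - s \<in> span ?S" by (intro span_base) auto
    then show ?case using s(1) span_add by fastforce
  qed
  then show ?thesis using exists_int_poly assms(3) by blast
qed

end

section \<open>Weights of representations of sl3\<close>

definition mat_unit :: "3 \<Rightarrow> 3 \<Rightarrow> complex \<Rightarrow> complex^3^3" where
  "mat_unit i j a = (\<chi> k l. if k = i \<and> l = j then a else 0)"

text \<open>The complex parameter covers the whole Cartan subalgebra: a = 1 gives the real torus on
  which weights are read, and a = \<open>\<i>\<close> the compact directions.\<close>

definition coroot :: "3 \<Rightarrow> 3 \<Rightarrow> complex \<Rightarrow> complex^3^3" where
  "coroot i j a = mat_unit i i a - mat_unit j j a"

lemma mat_unit_nth: "mat_unit i j a $ k $ l = (if k = i \<and> l = j then a else 0)"
  by (simp add: mat_unit_def)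

lemma mat_unit_mult: "mat_unit i j a ** mat_unit k l b = (if j = k then mat_unit i l (a * b) else 0)"
proof -
  have "(\<Sum>m\<in>UNIV. (if x = i \<and> m = j then a else 0) * (if m = k \<and> y = l then b else 0))
      = (\<Sum>m\<in>UNIV. if m = j then (if x = i \<and> j = k \<and> y = l then a * b else 0) else 0)" for x y
    by (rule sum.cong) auto
  then show ?thesis
    by (simp add: vec_eq_iff matrix_matrix_mult_def mat_unit_nth)
qed

lemma mat_unit_add: "mat_unit i j (a + b) = mat_unit i j a + mat_unit i j b"
  by (simp add: vec_eq_iff mat_unit_nth)

lemma mat_unit_scale: "mat_unit i j (of_real r * a) = r *\<^sub>R mat_unit i j a"
  by (simp add: vec_eq_iff mat_unit_nth) (simp add: scaleR_conv_of_real)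

lemma mat_unit_minus: "mat_unit i j (- a) = - mat_unit i j a"
  by (simp add: vec_eq_iff mat_unit_nth)

lemma mat_unit_0 [simp]: "mat_unit i j 0 = 0"
  by (simp add: vec_eq_iff mat_unit_nth)

lemma trace_mat_unit: "trace (mat_unit i j a) = (if i = j then a else 0)"
proof -
  have "(\<Sum>k\<in>UNIV. if k = i \<and> k = j then a else 0) = (\<Sum>k\<in>UNIV. if k = i then (if i = j then a else 0) else 0)"
    by (rule sum.cong) auto
  then show ?thesis by (simp add: trace_def mat_unit_nth)
qed

lemma mat_unit_sl3 [simp]: "i \<noteq> j \<Longrightarrow> mat_unit i j a \<in> sl3"
  by (simp add: sl3_def trace_mat_unit)

lemma zero_sl3 [simp]: "0 \<in> sl3"
  by (simp add: sl3_def trace_def)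

lemma coroot_sl3 [simp]: "coroot i j a \<in> sl3"
  by (simp add: sl3_def coroot_def trace_sub trace_mat_unit)

lemma sl3_add [intro]: "X \<in> sl3 \<Longrightarrow> Y \<in> sl3 \<Longrightarrow> X + Y \<in> sl3"
  by (simp add: sl3_def trace_add)

lemma coroot_add: "coroot i j (a + b) = coroot i j a + coroot i j b"
  by (simp add: coroot_def mat_unit_add)

lemma coroot_scale: "coroot i j (of_real r * a) = r *\<^sub>R coroot i j a"
  by (simp add: coroot_def mat_unit_scale scaleR_diff_right)

lemma coroot_swap: "coroot j i a = - coroot i j a"
  by (simp add: coroot_def)

lemma coroot_trans: "coroot i k a = coroot i j a + coroot j k a"
  by (simp add: coroot_def)

lemma matrix_diff_ldistrib: "A ** (B - C) = A ** B - A ** (C :: 'a::ring_1^'n^'m)"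
  by (simp add: vec_eq_iff matrix_matrix_mult_def sum_subtractf algebra_simps)

lemma matrix_diff_rdistrib: "(A - B) ** C = A ** C - B ** (C :: 'a::ring_1^'n^'m)"
  by (simp add: vec_eq_iff matrix_matrix_mult_def sum_subtractf algebra_simps)

lemma bracket_opposite: "i \<noteq> j \<Longrightarrow> lie_bracket (mat_unit i j a) (mat_unit j i b) = coroot i j (a * b)"
  by (simp add: lie_bracket_def mat_unit_mult coroot_def mult.commute)

lemma bracket_chain:
  "i \<noteq> k \<Longrightarrow> lie_bracket (mat_unit i j a) (mat_unit j k b) = mat_unit i k (a * b)"
  by (simp add: lie_bracket_def mat_unit_mult)

lemma bracket_chain':
  "k \<noteq> j \<Longrightarrow> lie_bracket (mat_unit i j a) (mat_unit k i b) = - mat_unit k j (a * b)"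
  by (simp add: lie_bracket_def mat_unit_mult mult.commute)

lemma bracket_commuting:
  "j \<noteq> k \<Longrightarrow> l \<noteq> i \<Longrightarrow> lie_bracket (mat_unit i j a) (mat_unit k l b) = 0"
  by (simp add: lie_bracket_def mat_unit_mult)

text \<open>The pairing of the root eps_k - eps_l with the coroot of i and j.\<close>

definition root_value :: "3 \<Rightarrow> 3 \<Rightarrow> 3 \<Rightarrow> 3 \<Rightarrow> int" where
  "root_value i j k l = of_bool (i = k) - of_bool (i = l) - of_bool (j = k) + of_bool (j = l)"

lemma bracket_coroot_mat_unit:
  "lie_bracket (coroot i j a) (mat_unit k l b) = mat_unit k l (a * b * of_int (root_value i j k l))"
  by (auto simp: lie_bracket_def coroot_def matrix_diff_ldistrib matrix_diff_rdistrib mat_unit_mult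
      root_value_def vec_eq_iff mat_unit_nth)

lemma bracket_coroots: "lie_bracket (coroot i j a) (coroot k l b) = 0"
  by (auto simp: lie_bracket_def coroot_def matrix_diff_ldistrib matrix_diff_rdistrib mat_unit_mult
      mult.commute)

lemma UNIV_3_distinct:
  assumes "distinct [i, j, k :: 3]" shows "UNIV = {i, j, k}"
proof -
  have "card {i, j, k} = CARD(3)" using assms by simp
  then show ?thesis by (metis card_subset_eq finite subset_UNIV)
qed

lemma ex_third: "i \<noteq> j \<Longrightarrow> \<exists>k::3. distinct [i, j, k]"
proof -
  assume "i \<noteq> j"
  have "card {i, j} < CARD(3)" using card_insert_le_m1[of 2 "{j}" i] by (simp add: \<open>i \<noteq> j\<close>)
  then have "{i, j} \<noteq> UNIV" by auto
  then show ?thesis using \<open>i \<noteq> j\<close> by auto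
qed

lemma ex_distinct_3: "\<exists>j k::3. distinct [i, j, k]"
proof -
  have "\<exists>j. j \<noteq> i" by (metis one_neq_zero)
  then show ?thesis using ex_third by metis
qed

lemma distinct_3D:
  "distinct [i, j, k :: 3] \<Longrightarrow> i \<noteq> j \<and> j \<noteq> i \<and> i \<noteq> k \<and> k \<noteq> i \<and> j \<noteq> k \<and> k \<noteq> j"
  by auto

lemma exhaust_distinct_3: "distinct [i, j, k :: 3] \<Longrightarrow> x = i \<or> x = j \<or> x = k"
  using UNIV_3_distinct[of i j k] by auto

lemma sum_distinct_3: "distinct [i, j, k :: 3] \<Longrightarrow> sum f UNIV = f i + f j + (f k :: 'a::comm_monoid_add)"
  by (simp add: UNIV_3_distinct[of i j k] add.assoc)

lemma sl3_expand:
  assumes "X \<in> sl3" "distinct [i, j, k]"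
  shows "X = coroot i k (X $ i $ i) + coroot j k (X $ j $ j)
    + mat_unit i j (X $ i $ j) + mat_unit j i (X $ j $ i) + mat_unit i k (X $ i $ k)
    + mat_unit k i (X $ k $ i) + mat_unit j k (X $ j $ k) + mat_unit k j (X $ k $ j)"
proof -
  have "X $ i $ i + X $ j $ j + X $ k $ k = 0"
    using assms by (simp add: sl3_def trace_def sum_distinct_3[OF assms(2)])
  then have kk: "X $ k $ k = - X $ i $ i - X $ j $ j" by (simp add: algebra_simps add_eq_0_iff)
  show ?thesis
    unfolding vec_eq_iff
  proof (intro allI)
    fix x y
    show "X $ x $ y = (coroot i k (X $ i $ i) + coroot j k (X $ j $ j)
    + mat_unit i j (X $ i $ j) + mat_unit j i (X $ j $ i) + mat_unit i k (X $ i $ k)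
    + mat_unit k i (X $ k $ i) + mat_unit j k (X $ j $ k) + mat_unit k j (X $ k $ j)) $ x $ y"
      using exhaust_distinct_3[OF assms(2), of x] exhaust_distinct_3[OF assms(2), of y]
        distinct_3D[OF assms(2)] kk
      by (elim disjE) (simp_all add: coroot_def mat_unit_nth)
  qed
qed

text \<open>Opposite matrix units bracket to a coroot, so the off-diagonal units generate the Lie
  algebra. Equivariance and triviality then have to be checked only on them.\<close>

lemma sl3_induct [consumes 1, case_names mat_unit add bracket]:
  assumes "X \<in> sl3"
    and unit: "\<And>i j a. i \<noteq> j \<Longrightarrow> P (mat_unit i j a)"
    and add: "\<And>X Y. X \<in> sl3 \<Longrightarrow> Y \<in> sl3 \<Longrightarrow> P X \<Longrightarrow> P Y \<Longrightarrow> P (X + Y)"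
    and bracket: "\<And>X Y. X \<in> sl3 \<Longrightarrow> Y \<in> sl3 \<Longrightarrow> P X \<Longrightarrow> P Y \<Longrightarrow> P (lie_bracket X Y)"
  shows "P X"
proof -
  obtain i j k :: 3 where ijk: "distinct [i, j, k]" using ex_distinct_3 by blast
  have co: "P (coroot x y a)" if "x \<noteq> y" for x y a
    using bracket[of "mat_unit x y a" "mat_unit y x 1"] unit that
    by (simp add: bracket_opposite)
  show ?thesis
    using ijk co unit
    by (subst sl3_expand[OF assms(1) ijk]) (intro add sl3_add mat_unit_sl3 coroot_sl3; auto)
qed

section \<open>Root operators and weight spaces\<close>

locale sl3_rep =
  fixes \<rho> :: "complex^3^3 \<Rightarrow> 'w::euclidean_space \<Rightarrow> 'w"
  assumes rep: "is_real_rep \<rho>"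
begin

lemma rho_linear: "X \<in> sl3 \<Longrightarrow> linear (\<rho> X)"
  and rho_plus: "X \<in> sl3 \<Longrightarrow> Y \<in> sl3 \<Longrightarrow> \<rho> (X + Y) v = \<rho> X v + \<rho> Y v"
  and rho_scale: "X \<in> sl3 \<Longrightarrow> \<rho> (r *\<^sub>R X) v = r *\<^sub>R \<rho> X v"
  and rho_bracket: "X \<in> sl3 \<Longrightarrow> Y \<in> sl3 \<Longrightarrow> \<rho> (lie_bracket X Y) v = \<rho> X (\<rho> Y v) - \<rho> Y (\<rho> X v)"
  using rep by (auto simp: is_real_rep_def)

lemma rho_minus: "X \<in> sl3 \<Longrightarrow> \<rho> (- X) v = - \<rho> X v"
  using rho_scale[of X "-1" v] by simp

lemma rho_zero: "\<rho> 0 v = 0"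
  using rho_scale[of 0 0 v] by (simp add: sl3_def trace_def)

lemma rho_comm: "X \<in> sl3 \<Longrightarrow> Y \<in> sl3 \<Longrightarrow> \<rho> X (\<rho> Y v) = \<rho> Y (\<rho> X v) + \<rho> (lie_bracket X Y) v"
  by (simp add: rho_bracket)

definition u :: "3 \<Rightarrow> 3 \<Rightarrow> complex \<Rightarrow> 'w \<Rightarrow> 'w" where
  "u i j a = \<rho> (mat_unit i j a)"

definition h :: "3 \<Rightarrow> 3 \<Rightarrow> complex \<Rightarrow> 'w \<Rightarrow> 'w" where
  "h i j a = \<rho> (coroot i j a)"

lemma linear_u: "i \<noteq> j \<Longrightarrow> linear (u i j a)"
  by (simp add: u_def rho_linear)

lemma linear_h: "linear (h i j a)"
  by (simp add: h_def rho_linear)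

lemma u_arg:
  assumes "i \<noteq> j"
  shows "u i j a (v + w) = u i j a v + u i j a w" "u i j a (v - w) = u i j a v - u i j a w"
    "u i j a (- v) = - u i j a v" "u i j a (r *\<^sub>R v) = r *\<^sub>R u i j a v" "u i j a 0 = 0"
  using linear_u[OF assms] by (auto simp: linear_add linear_diff linear_neg linear_scale linear_0)

lemma h_arg [simp]:
  "h i j a (v + w) = h i j a v + h i j a w" "h i j a (v - w) = h i j a v - h i j a w"
  "h i j a (- v) = - h i j a v" "h i j a (r *\<^sub>R v) = r *\<^sub>R h i j a v" "h i j a 0 = 0"
  using linear_h by (auto simp: linear_add linear_diff linear_neg linear_scale linear_0)

lemma u_coeff:
  assumes "i \<noteq> j"
  shows "u i j (a + b) v = u i j a v + u i j b v" "u i j (of_real r * a) v = r *\<^sub>R u i j a v"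
    "u i j (- a) v = - u i j a v" "u i j 0 v = 0"
  using assms rho_scale[of "mat_unit i j a" "-1" v]
  by (auto simp: u_def mat_unit_add rho_plus mat_unit_scale rho_scale rho_zero mat_unit_minus)

lemma h_coeff:
  shows "h i j (a + b) v = h i j a v + h i j b v" "h i j (of_real r * a) v = r *\<^sub>R h i j a v"
    "h i j (- a) v = - h i j a v"
  using rho_scale[of "coroot i j a" "-1" v] coroot_scale[of i j "-1" a]
  by (auto simp: h_def coroot_add rho_plus coroot_scale rho_scale)

lemma h_swap: "h j i a v = - h i j a v"
  by (simp add: h_def coroot_swap[of i j] rho_minus)

lemma h_trans: "h i k a v = h i j a v + h j k a v"
  by (simp add: h_def coroot_trans[of i k a j] rho_plus)

lemma u_u_opposite: "i \<noteq> j \<Longrightarrow> u i j a (u j i b v) = u j i b (u i j a v) + h i j (a * b) v"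
  unfolding u_def h_def by (subst rho_comm) (auto simp: bracket_opposite)

lemma u_u_chain:
  "distinct [i, j, k] \<Longrightarrow> u i j a (u j k b v) = u j k b (u i j a v) + u i k (a * b) v"
  unfolding u_def h_def by (subst rho_comm) (auto simp: bracket_chain)

lemma u_u_chain':
  "distinct [i, j, k] \<Longrightarrow> u i j a (u k i b v) = u k i b (u i j a v) - u k j (a * b) v"
  unfolding u_def h_def by (subst rho_comm) (auto simp: bracket_chain' rho_minus)

lemma u_u_commute:
  "i \<noteq> j \<Longrightarrow> k \<noteq> l \<Longrightarrow> j \<noteq> k \<Longrightarrow> l \<noteq> i \<Longrightarrow> u i j a (u k l b v) = u k l b (u i j a v)"
  unfolding u_def h_def by (subst rho_comm) (auto simp: bracket_commuting rho_zero)

lemma h_u: "k \<noteq> l \<Longrightarrow> h i j a (u k l b v) = u k l b (h i j a v) + u k l (a * b * of_int (root_value i j k l)) v"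
  unfolding u_def h_def by (subst rho_comm) (auto simp: bracket_coroot_mat_unit)

lemma h_h: "h i j a (h k l b v) = h k l b (h i j a v)"
  unfolding u_def h_def by (subst rho_comm) (auto simp: bracket_coroots rho_zero)

text \<open>A weight is a function on the three diagonal places, taken modulo constants: only its
  differences are used, so distinct \<open>c\<close> may give the same \<open>Wt c\<close>.\<close>
definition Wt :: "(3 \<Rightarrow> int) \<Rightarrow> 'w set" where
  "Wt c = {v. \<forall>i j. h i j 1 v = of_int (c i - c j) *\<^sub>R v}"

definition is_weight :: "(3 \<Rightarrow> int) \<Rightarrow> bool" where
  "is_weight c \<longleftrightarrow> (\<exists>v\<in>Wt c. v \<noteq> 0)"

definition shift :: "(3 \<Rightarrow> int) \<Rightarrow> 3 \<Rightarrow> 3 \<Rightarrow> 3 \<Rightarrow> int" where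
  "shift c k l = (\<lambda>i. c i + of_bool (i = k) - of_bool (i = l))"

lemma Wt_h: "v \<in> Wt c \<Longrightarrow> h i j 1 v = of_int (c i - c j) *\<^sub>R v"
  by (simp add: Wt_def)

lemma subspace_Wt: "subspace (Wt c)"
  by (auto simp: subspace_def Wt_def scaleR_add_right)

lemma Wt_closed:
  "0 \<in> Wt c" "v \<in> Wt c \<Longrightarrow> w \<in> Wt c \<Longrightarrow> v + w \<in> Wt c" "v \<in> Wt c \<Longrightarrow> w \<in> Wt c \<Longrightarrow> v - w \<in> Wt c"
  "v \<in> Wt c \<Longrightarrow> r *\<^sub>R v \<in> Wt c" "v \<in> Wt c \<Longrightarrow> - v \<in> Wt c"
  using subspace_Wt[of c]
  by (auto simp: subspace_0 subspace_add subspace_diff subspace_scale subspace_neg)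

lemma Wt_u: "v \<in> Wt c \<Longrightarrow> k \<noteq> l \<Longrightarrow> u k l b v \<in> Wt (shift c k l)"
proof -
  assume v: "v \<in> Wt c" and kl: "k \<noteq> l"
  have "h i j 1 (u k l b v) = of_int (shift c k l i - shift c k l j) *\<^sub>R u k l b v" for i j
  proof -
    have "h i j 1 (u k l b v) = of_int (c i - c j) *\<^sub>R u k l b v + of_int (root_value i j k l) *\<^sub>R u k l b v"
      using u_coeff(2)[OF kl, of "of_int (root_value i j k l)" b v]
      by (simp add: h_u[OF kl] Wt_h[OF v] u_arg[OF kl] mult.commute)
    also have "\<dots> = of_int (c i - c j + root_value i j k l) *\<^sub>R u k l b v"
      by (simp only: of_int_add scaleR_add_left)
    also have "c i - c j + root_value i j k l = shift c k l i - shift c k l j"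
      by (simp add: shift_def root_value_def)
    finally show ?thesis .
  qed
  then show ?thesis by (simp add: Wt_def)
qed

lemma Wt_h_closed: "v \<in> Wt c \<Longrightarrow> h i j a v \<in> Wt c"
  by (auto simp: Wt_def h_h[of _ _ 1])

lemma Wt_I:
  assumes "distinct [i, j, k]" "h i j 1 v = of_int (c i - c j) *\<^sub>R v" "h j k 1 v = of_int (c j - c k) *\<^sub>R v"
  shows "v \<in> Wt c"
proof -
  have ik: "h i k 1 v = of_int (c i - c k) *\<^sub>R v"
    using assms(2,3) by (simp add: h_trans[of i k 1 v j] flip: scaleR_add_left)
  have "h x x 1 v = 0" for x using h_trans[of x x 1 v x] by simp
  then have "h x y 1 v = of_int (c x - c y) *\<^sub>R v" for x y
    using exhaust_distinct_3[OF assms(1), of x] exhaust_distinct_3[OF assms(1), of y]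
      assms(2,3) ik h_swap[of j i 1 v] h_swap[of k i 1 v] h_swap[of k j 1 v]
    by (elim disjE) (simp_all add: algebra_simps)
  then show ?thesis by (simp add: Wt_def)
qed

text \<open>Passes between representatives of a weight that differ by a constant; two consecutive
  differences determine the third.\<close>

lemma Wt_mono:
  assumes "v \<in> Wt c" "distinct [i, j, k]" "c i - c j = d i - d j" "c j - c k = d j - d k"
  shows "v \<in> Wt d"
  using assms by (intro Wt_I[OF assms(2)]) (simp_all add: Wt_h)

lemma sl2:
  assumes ij: "i \<noteq> j" shows "sl2_triple (u i j 1) (u j i 1) (h i j 1)"
proof (rule sl2_triple.intro)
  have two: "u k l 2 v = 2 *\<^sub>R u k l 1 v" if "k \<noteq> l" for k l v
    using u_coeff(2)[OF that, of 2 1 v] by simp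
  show "linear (u i j 1)" "linear (u j i 1)" "linear (h i j 1)"
    using ij by (simp_all add: linear_u linear_h)
  show "h i j 1 (u i j 1 v) = u i j 1 (h i j 1 v) + 2 *\<^sub>R u i j 1 v" for v
    using ij two[of i j v] by (simp add: h_u[of i j] root_value_def)
  show "h i j 1 (u j i 1 v) = u j i 1 (h i j 1 v) - 2 *\<^sub>R u j i 1 v" for v
    using ij two[of j i v] u_coeff(3)[of j i 2 v] by (simp add: h_u[of j i] root_value_def)
  show "u i j 1 (u j i 1 v) = u j i 1 (u i j 1 v) + h i j 1 v" for v
    using u_u_opposite[OF ij, of 1 1 v] by simp
qed

text \<open>\<open>h i j 1\<close> is diagonalised on the whole space and \<open>h j k 1\<close> on
  each of its eigenspaces, which are stable because the torus is commutative. The two coroots span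
  the real torus.\<close>

lemma span_Wt: "v \<in> span (\<Union>c. Wt c)"
proof -
  obtain i j k :: 3 where ijk: "distinct [i, j, k]" using ex_distinct_3 by blast
  interpret s1: sl2_triple "u i j 1" "u j i 1" "h i j 1" using ijk by (intro sl2) auto
  interpret s2: sl2_triple "u j k 1" "u k j 1" "h j k 1" using ijk by (intro sl2) auto
  have "{x \<in> UNIV. \<exists>n::int. h i j 1 x = of_int n *\<^sub>R x} \<subseteq> span (\<Union>c. Wt c)"
  proof safe
    fix x and n :: int
    assume n: "h i j 1 x = of_int n *\<^sub>R x"
    let ?Z = "{z. h i j 1 z = of_int n *\<^sub>R z}"
    have "x \<in> span {z \<in> ?Z. \<exists>m::int. h j k 1 z = of_int m *\<^sub>R z}"
      by (rule s2.H_diagonalisable) (use n in \<open>auto simp: subspace_def scaleR_add_right h_h[of i j]\<close>)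
    moreover have "{z \<in> ?Z. \<exists>m::int. h j k 1 z = of_int m *\<^sub>R z} \<subseteq> (\<Union>c. Wt c)"
    proof safe
      fix z and m :: int
      assume "h i j 1 z = of_int n *\<^sub>R z" "h j k 1 z = of_int m *\<^sub>R z"
      \<comment> \<open>The representative normalised to 0 at j, with successive differences n and
        m.\<close>
      then have "z \<in> Wt (\<lambda>x. if x = i then n else if x = k then - m else 0)"
        using ijk by (intro Wt_I[OF ijk]) auto
      then show "z \<in> (\<Union>c. Wt c)" by blast
    qed
    ultimately show "x \<in> span (\<Union>c. Wt c)" using span_mono by blast
  qed
  moreover have "v \<in> span {x \<in> UNIV. \<exists>n::int. h i j 1 x = of_int n *\<^sub>R x}"
    by (rule s1.H_diagonalisable) auto
  ultimately show ?thesis using span_minimal[OF _ subspace_span] by blast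
qed

lemma Wt_induct [case_names weight add]:
  assumes "\<And>c v. v \<in> Wt c \<Longrightarrow> P v" "\<And>v w. P v \<Longrightarrow> P w \<Longrightarrow> P (v + w)"
  shows "P v"
  using span_Wt[of v]
proof (induction rule: span_induct_alt)
  case base
  show ?case by (rule assms(1)) (rule Wt_closed(1))
next
  case (step r x y)
  then show ?case using assms Wt_closed(4) by blast
qed

lemma finite_eigenvalues:
  fixes T :: "'w \<Rightarrow> 'w" assumes "linear T"
  shows "finite {l. \<exists>v. v \<noteq> 0 \<and> T v = l *\<^sub>R v}"
proof -
  obtain p where p: "p \<noteq> 0" "\<And>v. opoly T p v = 0"
    using exists_annihilating_poly[OF assms] by blast
  have "{l. \<exists>v. v \<noteq> 0 \<and> T v = l *\<^sub>R v} \<subseteq> {l. poly p l = 0}"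
  proof safe
    fix l v assume "v \<noteq> 0" "T v = l *\<^sub>R v"
    then show "poly p l = 0" using p(2)[of v] opoly_eigenvector[OF assms, of v l p] by simp
  qed
  then show ?thesis using p(1) poly_roots_finite finite_subset by blast
qed

end

text \<open>Summing over pairs makes this Weyl-invariant and insensitive to constants: it is six
  times the squared length of the representative with sum zero.\<close>

definition wnorm :: "(3 \<Rightarrow> int) \<Rightarrow> int" where
  "wnorm c = (\<Sum>i\<in>UNIV. \<Sum>j\<in>UNIV. (c i - c j)\<^sup>2)"

lemma wnorm_eq:
  "distinct [i, j, k] \<Longrightarrow> wnorm c = 2 * ((c i - c j)\<^sup>2 + (c j - c k)\<^sup>2 + (c i - c k)\<^sup>2)"
  by (simp add: wnorm_def sum_distinct_3 power2_eq_square algebra_simps)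

lemma (in sl3_rep) finite_wnorms: "finite {wnorm c |c. is_weight c}"
proof -
  obtain i j k :: 3 where ijk: "distinct [i, j, k]" using ex_distinct_3 by blast
  let ?S = "\<lambda>i j. {l. \<exists>v. v \<noteq> 0 \<and> h i j 1 v = l *\<^sub>R v}"
  let ?f = "\<lambda>(x::real, y). 2 * (x\<^sup>2 + y\<^sup>2 + (x + y)\<^sup>2)"
  have "of_int ` {wnorm c |c. is_weight c} \<subseteq> ?f ` (?S i j \<times> ?S j k)"
  proof safe
    fix c assume "is_weight c"
    then obtain v where v: "v \<in> Wt c" "v \<noteq> 0" by (auto simp: is_weight_def)
    then have mem: "(of_int (c i - c j), of_int (c j - c k)) \<in> ?S i j \<times> ?S j k"
      using Wt_h[OF v(1)] by blast
    have "of_int (wnorm c) = ?f (of_int (c i - c j), of_int (c j - c k))"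
      by (simp add: wnorm_eq[OF ijk])
    then show "real_of_int (wnorm c) \<in> ?f ` (?S i j \<times> ?S j k)"
      using mem by (rule image_eqI)
  qed
  moreover have "finite (?f ` (?S i j \<times> ?S j k))"
    by (intro finite_imageI finite_cartesian_product finite_eigenvalues linear_h)
  ultimately have "finite (real_of_int ` {wnorm c |c. is_weight c})" by (rule finite_subset)
  then show ?thesis by (rule finite_imageD) (auto simp: inj_on_def)
qed

section \<open>Consequences of the nondegeneracy of the wedge product\<close>

text \<open>On pairs rather than sets, so that equal vectors count as dependent.\<close>

definition lin_indep2 :: "'a::real_vector \<Rightarrow> 'a \<Rightarrow> bool" where
  "lin_indep2 a b \<longleftrightarrow> (\<forall>r s. r *\<^sub>R a + s *\<^sub>R b = 0 \<longrightarrow> r = 0 \<and> s = 0)"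

lemma lin_indep2_span:
  assumes "lin_indep2 a b" shows "dim (span {a, b}) = 2"
proof -
  have "a \<noteq> b"
  proof
    assume "a = b"
    then have "1 *\<^sub>R a + (-1) *\<^sub>R b = 0" by simp
    then show False using assms unfolding lin_indep2_def by fastforce
  qed
  moreover have "independent {a, b}"
    using assms \<open>a \<noteq> b\<close> by (auto simp: dependent_finite lin_indep2_def)
  ultimately show ?thesis using \<open>a \<noteq> b\<close> by (simp add: dim_eq_card_independent)
qed

text \<open>Raising back gives \<open>fact k\<close> times the falling factorial of m times v, which
  is nonzero as long as k <= m.\<close>

lemma sl2_string_nonzero:
  assumes "sl2_triple E F H" "E v = 0" "H v = real m *\<^sub>R v" "v \<noteq> 0" "k \<le> m"
  shows "(F ^^ k) v \<noteq> 0"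
proof
  interpret sl2_triple E F H by fact
  assume "(F ^^ k) v = 0"
  then have "poly (falling k) (real m) *\<^sub>R v = 0"
    using E_pow_F_pow[OF assms(2), of k] opoly_eigenvector[OF linear_H assms(3)]
      linear_0[OF E_pow_linear] by simp
  then show False using assms(4,5) by (auto simp: falling_def poly_prod)
qed

definition single :: "3 \<Rightarrow> int \<Rightarrow> 3 \<Rightarrow> int" where
  "single k n = (\<lambda>i. if i = k then n else 0)"

lemma wnorm_scale: "wnorm (\<lambda>i. s * c i) = s\<^sup>2 * wnorm c"
  by (simp add: wnorm_def sum_distrib_left power2_eq_square algebra_simps)

lemma wnorm_single: "wnorm (single k n) = 4 * n\<^sup>2"
proof -
  obtain i j where kij: "distinct [k, i, j]" using ex_distinct_3 by blast
  then show ?thesis using distinct_3D[OF kij] by (simp add: wnorm_eq[OF kij] single_def)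
qed

section \<open>Weights of maximal norm and their reflections\<close>

context sl3_rep
begin

lemma is_weight_cong:
  assumes "distinct [i, j, k]" "c i - c j = d i - d j" "c j - c k = d j - d k"
  shows "is_weight c \<longleftrightarrow> is_weight d"
  using Wt_mono[OF _ assms(1), of _ c d] Wt_mono[OF _ assms(1), of _ d c] assms
  unfolding is_weight_def by (metis (no_types, lifting))

lemma u_pow_Wt:
  assumes "v \<in> Wt c" "i \<noteq> j"
  shows "(u j i a ^^ k) v \<in> Wt (\<lambda>x. c x - int k * of_bool (x = i) + int k * of_bool (x = j))"
proof (induction k)
  case 0
  then show ?case using assms by simp
next
  case (Suc k)
  obtain l where ijl: "distinct [i, j, l]" using ex_third assms(2) by blast
  have "u j i a ((u j i a ^^ k) v) \<in> Wt (shift (\<lambda>x. c x - int k * of_bool (x = i) + int k * of_bool (x = j)) j i)"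
    using Suc assms by (intro Wt_u) auto
  then show ?case
    using ijl by (auto intro: Wt_mono[OF _ ijl] simp: shift_def)
qed

text \<open>Maximality in a Weyl-invariant norm, not in an order depending on a positive system, so
  that it passes to reflected weights.\<close>

definition top_weight :: "(3 \<Rightarrow> int) \<Rightarrow> bool" where
  "top_weight c \<longleftrightarrow> is_weight c \<and> wnorm c > 0 \<and> (\<forall>d. is_weight d \<longrightarrow> wnorm d \<le> wnorm c)"

lemma top_weightD: "top_weight c \<Longrightarrow> wnorm c < wnorm d \<Longrightarrow> \<not> is_weight d"
  by (force simp: top_weight_def)

lemma not_weight_zero: "v \<in> Wt c \<Longrightarrow> \<not> is_weight c \<Longrightarrow> v = 0"
  by (auto simp: is_weight_def)

text \<open>If 0 were the only weight, a root operator would move every weight vector outside the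
  set of weights and hence vanish, against faithfulness.\<close>

lemma exists_top_weight:
  assumes "inj_on \<rho> sl3"
  shows "\<exists>c. top_weight c"
proof -
  obtain i j k :: 3 where ijk: "distinct [i, j, k]" using ex_distinct_3 by blast
  have "\<exists>c. is_weight c \<and> wnorm c > 0"
  proof (rule ccontr)
    assume none: "\<nexists>c. is_weight c \<and> wnorm c > 0"
    have "u i j 1 v = 0" for v
    proof (induction v rule: Wt_induct)
      case (weight c v)
      show ?case
      proof (cases "v = 0")
        case True
        then show ?thesis using ijk by (simp add: u_arg)
      next
        case False
        then have "is_weight c" using weight by (auto simp: is_weight_def)
        then have "\<not> wnorm c > 0" using none by blast
        then have "2 * ((c i - c j)\<^sup>2 + (c j - c k)\<^sup>2 + (c i - c k)\<^sup>2) \<le> 0"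
          by (simp only: wnorm_eq[OF ijk] not_less)
        moreover have "x = 0 \<and> y = 0" if "0 \<le> x" "0 \<le> y" "0 \<le> z" "2 * (x + y + z) \<le> 0"
          for x y z :: int using that by presburger
        ultimately have "(c i - c j)\<^sup>2 = 0 \<and> (c j - c k)\<^sup>2 = 0" by (meson zero_le_power2)
        then have "c i = c j \<and> c j = c k" by simp
        then have "wnorm (shift c i j) > 0"
          using ijk by (simp add: wnorm_eq[OF ijk] shift_def)
        then have "\<not> is_weight (shift c i j)" using none by blast
        then show ?thesis using weight ijk by (intro not_weight_zero[OF Wt_u]) auto
      qed
    next
      case (add v w)
      then show ?case using ijk by (simp add: u_arg)
    qed
    then have "\<rho> (mat_unit i j 1) = \<rho> 0" by (auto simp: u_def rho_zero)
    then have "mat_unit i j 1 = 0"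
      using ijk by (intro inj_onD[OF assms]) auto
    then have "mat_unit i j 1 $ i $ j = 0" by simp
    then show False by (simp add: mat_unit_nth)
  qed
  then obtain c0 where c0: "is_weight c0" "wnorm c0 > 0" by blast
  let ?S = "{wnorm c |c. is_weight c}"
  have ne: "?S \<noteq> {}" using c0 by blast
  have "Max ?S \<in> ?S" by (rule Max_in[OF finite_wnorms ne])
  then obtain c where c: "is_weight c" "wnorm c = Max ?S" by auto
  have "wnorm d \<le> wnorm c" if "is_weight d" for d
    unfolding c(2) using that by (intro Max_ge[OF finite_wnorms]) auto
  then show ?thesis using c c0 unfolding top_weight_def by fastforce
qed

text \<open>Adding a root that pairs positively with c increases the norm.\<close>

lemma top_weight_raise:
  assumes "top_weight c" "v \<in> Wt c" "c i > c j"
  shows "u i j a v = 0"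
proof -
  have "i \<noteq> j" using assms(3) by auto
  then obtain k where ijk: "distinct [i, j, k]" using ex_third by blast
  have "0 < (c i - c j)" using assms(3) by simp
  then have "wnorm c < wnorm (shift c i j)"
    using distinct_3D[OF ijk] by (simp add: wnorm_eq[OF ijk] shift_def power2_eq_square algebra_simps)
  then show ?thesis
    using top_weightD[OF assms(1)] Wt_u[OF assms(2) \<open>i \<noteq> j\<close>] not_weight_zero by blast
qed

text \<open>A vector of weight c is singular for the triple at i, j, so c i - c j lowerings reach
  the reflected weight without vanishing.\<close>

lemma top_weight_reflect:
  assumes "top_weight c" "c i > c j"
  shows "is_weight (\<lambda>x. if x = i then c j else if x = j then c i else c x)" (is "is_weight ?d")
proof -
  have "i \<noteq> j" using assms(2) by auto
  then obtain k where ijk: "distinct [i, j, k]" using ex_third by blast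
  obtain v where v: "v \<in> Wt c" "v \<noteq> 0" using assms(1) by (auto simp: top_weight_def is_weight_def)
  define m where "m = nat (c i - c j)"
  have m: "int m = c i - c j" using assms(2) by (simp add: m_def)
  have "(u j i 1 ^^ m) v \<noteq> 0"
  proof (rule sl2_string_nonzero[OF sl2[OF \<open>i \<noteq> j\<close>]])
    show "u i j 1 v = 0" by (rule top_weight_raise[OF assms(1) v(1) assms(2)])
    have "real m = of_int (c i - c j)" using m by (metis of_int_of_nat_eq)
    then show "h i j 1 v = real m *\<^sub>R v" using Wt_h[OF v(1)] by simp
  qed (use v in auto)
  moreover have "(u j i 1 ^^ m) v \<in> Wt ?d"
    by (rule Wt_mono[OF u_pow_Wt[OF v(1) \<open>i \<noteq> j\<close>] ijk])
       (use distinct_3D[OF ijk] m in auto)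
  ultimately show ?thesis by (auto simp: is_weight_def)
qed

lemma lin_indep2_weights:
  assumes "a \<in> Wt c" "b \<in> Wt d" "a \<noteq> 0" "b \<noteq> 0" "c i - c j \<noteq> d i - d j"
  shows "lin_indep2 a b"
  unfolding lin_indep2_def
proof (intro allI impI)
  fix r s assume rs: "r *\<^sub>R a + s *\<^sub>R b = 0"
  let ?m = "of_int (c i - c j) :: real" and ?n = "of_int (d i - d j) :: real"
  have "?m *\<^sub>R (r *\<^sub>R a) + ?n *\<^sub>R (s *\<^sub>R b) = h i j 1 (r *\<^sub>R a + s *\<^sub>R b)"
    by (simp add: Wt_h[OF assms(1)] Wt_h[OF assms(2)] mult.commute)
  then have "?m *\<^sub>R (r *\<^sub>R a) + ?n *\<^sub>R (s *\<^sub>R b) = 0" by (simp add: rs)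
  moreover have b: "s *\<^sub>R b = - (r *\<^sub>R a)" using rs by (simp add: add_eq_0_iff)
  ultimately have "(?m - ?n) *\<^sub>R (r *\<^sub>R a) = 0" by (simp add: algebra_simps)
  moreover have "?m - ?n \<noteq> 0" using assms(5) by (metis of_int_eq_iff right_minus_eq)
  ultimately have "r = 0" using assms(3) by simp
  then show "r = 0 \<and> s = 0" using b assms(4) by simp
qed

end

locale sl3_wedge = sl3_rep \<rho>
  for \<rho> :: "complex^3^3 \<Rightarrow> 'w::euclidean_space \<Rightarrow> 'w" +
  fixes wedge :: "'w \<Rightarrow> 'w \<Rightarrow> 'w \<Rightarrow> real"
  assumes faithful: "inj_on \<rho> sl3"
    and wedge_bilinear: "\<forall>z. bilinear (\<lambda>a b. wedge a b z)"
    and wedge_dual: "\<forall>a b. linear (wedge a b)"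
    and wedge_sym: "\<forall>a b. wedge a b = wedge b a"
    and wedge_equivariant: "\<forall>X\<in>sl3. \<forall>a b z.
          - wedge a b (\<rho> X z) = wedge (\<rho> X a) b z + wedge a (\<rho> X b) z"
    and wedge_nondeg: "\<forall>P. subspace P \<and> dim P = 2 \<longrightarrow>
          (\<exists>a\<in>P. \<exists>b\<in>P. wedge a b \<noteq> (\<lambda>_. 0))"
begin

lemma wedge_arith:
  "wedge (a + b) c z = wedge a c z + wedge b c z" "wedge c (a + b) z = wedge c a z + wedge c b z"
  "wedge (r *\<^sub>R a) c z = r * wedge a c z" "wedge c (r *\<^sub>R a) z = r * wedge c a z"
  "wedge a c (z + z') = wedge a c z + wedge a c z'" "wedge a c (r *\<^sub>R z) = r * wedge a c z"
  "wedge a c 0 = 0"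
  using wedge_bilinear wedge_dual
  by (auto simp: bilinear_def linear_iff linear_0)

lemma wedge_weights_zero:
  assumes "a \<in> Wt c" "b \<in> Wt d" "\<not> is_weight (\<lambda>x. - c x - d x)"
  shows "wedge a b = (\<lambda>_. 0)"
proof
  fix z show "wedge a b z = 0"
  proof (induction z rule: Wt_induct)
    case (weight e z)
    show ?case
    proof (cases "\<forall>i j. e i - e j = (- c i - d i) - (- c j - d j)")
      case True
      then have "z \<in> Wt (\<lambda>x. - c x - d x)" using weight by (simp add: Wt_def)
      then show ?thesis using assms(3) not_weight_zero wedge_arith(7) by blast
    next
      case False
      then obtain i j where "e i - e j \<noteq> (- c i - d i) - (- c j - d j)" by blast
      then have ij: "(c i - c j) + (d i - d j) + (e i - e j) \<noteq> 0" (is "?s \<noteq> 0") by linarith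
      have "- wedge a b (h i j 1 z) = wedge (h i j 1 a) b z + wedge a (h i j 1 b) z"
        using wedge_equivariant coroot_sl3 unfolding h_def by blast
      then have "of_int ?s * wedge a b z = 0"
        by (simp only: Wt_h[OF assms(1)] Wt_h[OF assms(2)] Wt_h[OF weight] wedge_arith)
           (simp add: algebra_simps)
      then show ?thesis using ij by (simp only: mult_eq_0_iff of_int_eq_0_iff) simp
    qed
  next
    case (add v w)
    then show ?case by (simp add: wedge_arith)
  qed
qed

lemma isotropic_dependent:
  assumes "wedge a a = (\<lambda>_. 0)" "wedge a b = (\<lambda>_. 0)" "wedge b b = (\<lambda>_. 0)"
  shows "\<not> lin_indep2 a b"
proof
  assume "lin_indep2 a b"
  then have "subspace (span {a, b}) \<and> dim (span {a, b}) = 2"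
    using lin_indep2_span subspace_span by blast
  then obtain x y where xy: "x \<in> span {a, b}" "y \<in> span {a, b}" "wedge x y \<noteq> (\<lambda>_. 0)"
    using wedge_nondeg by blast
  then obtain p q r s where "x = p *\<^sub>R a + q *\<^sub>R b" "y = r *\<^sub>R a + s *\<^sub>R b"
    by (auto simp: span_insert span_singleton algebra_simps)
  moreover have "wedge b a = (\<lambda>_. 0)" using assms(2) wedge_sym by metis
  ultimately show False using xy(3) assms by (auto simp: wedge_arith fun_eq_iff)
qed

lemma weight_of_independent_pair:
  assumes "a \<in> Wt c" "b \<in> Wt d" "lin_indep2 a b"
  shows "is_weight (\<lambda>x. - 2 * c x) \<or> is_weight (\<lambda>x. - c x - d x) \<or> is_weight (\<lambda>x. - 2 * d x)"
proof (rule ccontr)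
  assume not: "\<not> ?thesis"
  have "(\<lambda>x. - 2 * e x) = (\<lambda>x. - e x - e x)" for e :: "3 \<Rightarrow> int" by auto
  then have "wedge a a = (\<lambda>_. 0)" "wedge a b = (\<lambda>_. 0)" "wedge b b = (\<lambda>_. 0)"
    using not assms by (auto intro!: wedge_weights_zero)
  then show False using isotropic_dependent assms(3) by blast
qed

lemma weight_of_distinct_pair:
  assumes "is_weight c" "is_weight d" "c i - c j \<noteq> d i - d j"
  shows "is_weight (\<lambda>x. - 2 * c x) \<or> is_weight (\<lambda>x. - c x - d x) \<or> is_weight (\<lambda>x. - 2 * d x)"
  using assms weight_of_independent_pair lin_indep2_weights unfolding is_weight_def[of c] is_weight_def[of d] by blast

lemma double_not_weight:
  assumes "top_weight c" "wnorm d = wnorm c"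
  shows "\<not> is_weight (\<lambda>x. - 2 * d x)"
proof -
  have "wnorm c < wnorm (\<lambda>x. - 2 * d x)"
    using wnorm_scale[of "-2" d] assms by (simp add: top_weight_def)
  then show ?thesis using top_weightD[OF assms(1)] by blast
qed

text \<open>Let d be the reflection of c that exchanges i and j. With p = c i - c j and q = c j - c
  k, the norm of -c - d exceeds that of c by 12q(p + q), so the pair c, d forces a weight that is
  too long.\<close>

lemma top_weight_not_regular:
  assumes "top_weight c" "c i > c j" "c j > c k"
  shows False
proof -
  have ijk: "distinct [i, j, k]" using assms by auto
  let ?d = "\<lambda>x. if x = i then c j else if x = j then c i else c x"
  have d: "is_weight ?d" by (rule top_weight_reflect) (use assms in auto)
  have nd: "wnorm ?d = wnorm c"
    using distinct_3D[OF ijk] by (simp add: wnorm_eq[OF ijk] power2_eq_square algebra_simps)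
  have "is_weight (\<lambda>x. - 2 * c x) \<or> is_weight (\<lambda>x. - c x - ?d x) \<or> is_weight (\<lambda>x. - 2 * ?d x)"
    by (rule weight_of_distinct_pair[where i = i and j = j]) (use assms d in \<open>auto simp: top_weight_def\<close>)
  moreover have "wnorm c < wnorm (\<lambda>x. - c x - ?d x)"
  proof -
    define p q where "p = c i - c j" and "q = c j - c k"
    then have "p > 0" "q > 0" using assms by auto
    have "wnorm (\<lambda>x. - c x - ?d x) = 4 * (p + 2 * q)\<^sup>2"
      using distinct_3D[OF ijk] by (simp add: wnorm_eq[OF ijk] p_def q_def power2_eq_square algebra_simps)
    moreover have "wnorm c = 4 * (p * p + p * q + q * q)"
      by (simp add: wnorm_eq[OF ijk] p_def q_def power2_eq_square algebra_simps)
    moreover have "p * q > 0" "q * q > 0" using \<open>p > 0\<close> \<open>q > 0\<close> by auto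
    ultimately show ?thesis by (simp add: power2_eq_square algebra_simps)
  qed
  ultimately show False
    using top_weightD[OF assms(1)] double_not_weight[OF assms(1)] nd by blast
qed

text \<open>Two of the three values coincide, since sorting three distinct ones would give a regular
  weight; subtracting the common value leaves a multiple of some eps_i.\<close>

lemma top_weight_single:
  assumes "top_weight c"
  shows "\<exists>i n. n \<noteq> 0 \<and> top_weight (single i n)"
proof -
  have conv: "\<exists>i n. n \<noteq> 0 \<and> top_weight (single i n)"
    if ijk: "distinct [i, j, k]" and eq: "c j = c k" for i j k
  proof -
    have w: "is_weight (single i (c i - c j)) \<longleftrightarrow> is_weight c"
      using ijk eq by (intro is_weight_cong[OF ijk]) (auto simp: single_def)
    moreover have n: "wnorm (single i (c i - c j)) = wnorm c"
      using eq by (simp add: wnorm_single wnorm_eq[OF ijk, of c])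
    ultimately have "top_weight (single i (c i - c j))" using assms by (simp add: top_weight_def)
    moreover have "c i - c j \<noteq> 0" using calculation by (auto simp: top_weight_def wnorm_single)
    ultimately show ?thesis by blast
  qed
  obtain i j k :: 3 where ijk: "distinct [i, j, k]" using ex_distinct_3 by blast
  show ?thesis
  proof (rule ccontr)
    assume "\<not> ?thesis"
    then have "c i \<noteq> c j \<and> c j \<noteq> c k \<and> c i \<noteq> c k"
      using conv[of i j k] conv[of j i k] conv[of k i j] ijk by auto
    then show False
      using top_weight_not_regular[OF assms] by (metis linorder_less_linear)
  qed
qed

end

section \<open>The list of weights for a negative top weight\<close>

locale sl3_wedge_neg = sl3_wedge +
  fixes i0 :: 3 and n :: int
  assumes top: "top_weight (single i0 n)" and neg: "n < 0"
begin

lemma single_weight: "is_weight (single j n)"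
proof (cases "j = i0")
  case False
  have "is_weight (\<lambda>x. if x = j then single i0 n i0 else if x = i0 then single i0 n j else single i0 n x)"
    by (rule top_weight_reflect[OF top]) (use False neg in \<open>auto simp: single_def\<close>)
  also have "(\<lambda>x. if x = j then single i0 n i0 else if x = i0 then single i0 n j else single i0 n x) = single j n"
    using False by (auto simp: single_def)
  finally show ?thesis .
qed (use top in \<open>auto simp: top_weight_def\<close>)

text \<open>The images of a top vector under the two root vectors at (i0, j) are independent and
  share a weight, so -2 times that weight must occur. Its norm is at most maximal only if (n + 2)^2
  <= 0.\<close>

lemma n_eq: "n = -2"
proof -
  obtain j k where ijk: "distinct [i0, j, k]" using ex_distinct_3 by blast
  then have ij: "i0 \<noteq> j" "j \<noteq> i0" by auto
  obtain a where a: "a \<in> Wt (single i0 n)" "a \<noteq> 0" using single_weight is_weight_def by auto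
  have kill: "u j i0 b a = 0" for b
    by (rule top_weight_raise[OF top a(1)]) (use ij neg in \<open>auto simp: single_def\<close>)
  have uu: "u j i0 b (u i0 j b' a) = h j i0 (b * b') a" for b b'
    using u_u_opposite[OF ij(2)] kill ij by (simp add: u_arg)
  have h1: "h j i0 1 a = - (of_int n *\<^sub>R a)"
    using Wt_h[OF a(1)] ij by (simp add: single_def)
  have "lin_indep2 (u i0 j 1 a) (u i0 j \<i> a)"
    unfolding lin_indep2_def
  proof (intro allI impI)
    fix r s assume rs: "r *\<^sub>R u i0 j 1 a + s *\<^sub>R u i0 j \<i> a = 0"
    have e: "r *\<^sub>R h j i0 b a + s *\<^sub>R h j i0 (b * \<i>) a = 0" for b
      using arg_cong[OF rs, of "u j i0 b"] ij by (simp add: u_arg uu)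
    \<comment> \<open>g need not be a multiple of a. It is eliminated between the equations for b =
      1 and b = \<open>\<i>\<close>, which leaves (r^2 + s^2) n a = 0.\<close>
    define g where "g = h j i0 \<i> a"
    have sg: "s *\<^sub>R g = (r * n) *\<^sub>R a" using e[of 1] by (simp add: h1 g_def)
    have rg: "r *\<^sub>R g = - ((s * n) *\<^sub>R a)"
      using e[of \<i>] by (simp add: h1 g_def h_coeff(3) add_eq_0_iff2)
    have "(r * r * n) *\<^sub>R a = r *\<^sub>R (s *\<^sub>R g)" by (simp add: sg mult.assoc)
    also have "\<dots> = s *\<^sub>R (r *\<^sub>R g)" by (simp add: mult.commute)
    also have "\<dots> = - ((s * s * n) *\<^sub>R a)" by (simp add: rg mult.assoc)
    finally have "(r * r * n) *\<^sub>R a = - ((s * s * n) *\<^sub>R a)" .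
    then have "((r * r + s * s) * n) *\<^sub>R a = 0" by (simp add: algebra_simps add_eq_0_iff2)
    then show "r = 0 \<and> s = 0" using a(2) neg by (simp add: sum_squares_eq_zero_iff)
  qed
  then have "is_weight (\<lambda>x. - 2 * shift (single i0 n) i0 j x)"
    using weight_of_independent_pair[OF Wt_u[OF a(1) ij(1)] Wt_u[OF a(1) ij(1)]] by auto
  then have "wnorm (\<lambda>x. - 2 * shift (single i0 n) i0 j x) \<le> wnorm (single i0 n)"
    using top by (auto simp: top_weight_def)
  then have "4 * wnorm (shift (single i0 n) i0 j) \<le> 4 * n\<^sup>2"
    using wnorm_scale[of "-2" "shift (single i0 n) i0 j"] by (simp add: wnorm_single)
  moreover have "wnorm (shift (single i0 n) i0 j) = 2 * ((n + 2)\<^sup>2 + 1 + (n + 1)\<^sup>2)"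
    using distinct_3D[OF ijk]
    by (simp add: wnorm_eq[OF ijk] shift_def single_def power2_eq_square algebra_simps)
  ultimately have "4 * (2 * ((n + 2)\<^sup>2 + 1 + (n + 1)\<^sup>2)) \<le> 4 * n\<^sup>2" by simp
  then have "(n + 2)\<^sup>2 \<le> 0" by (simp add: power2_eq_square algebra_simps)
  then show ?thesis by simp
qed

text \<open>16 is the norm of -2 eps_k.\<close>

lemma not_weight: "wnorm c > 16 \<Longrightarrow> \<not> is_weight c"
  using top_weightD[OF top] by (simp add: wnorm_single n_eq)

lemma weight_neg2: "is_weight (single j (-2))"
  using single_weight n_eq by simp

text \<open>This and the next two exclusions pair the weight with -2 eps_j. Here the candidates -4
  eps_i, -2 eps_i + 2 eps_j and 4 eps_j all have norm above 16.\<close>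

lemma not_weight_2:
  assumes ijk: "distinct [i, j, k]" shows "\<not> is_weight (single i 2)"
proof
  assume "is_weight (single i 2)"
  then have "is_weight (\<lambda>x. - 2 * single i 2 x) \<or> is_weight (\<lambda>x. - single i 2 x - single j (-2) x)
      \<or> is_weight (\<lambda>x. - 2 * single j (-2) x)"
    by (rule weight_of_distinct_pair[where i = i and j = k, OF _ weight_neg2]) (use ijk in \<open>auto simp: single_def\<close>)
  then show False
    using ijk not_weight by (auto simp: wnorm_eq[OF ijk] single_def)
qed

text \<open>Modulo constants c is the root eps_i - eps_j; together with -2 eps_j it would force a
  weight of norm 48, 52 or 64.\<close>

lemma not_weight_root:
  assumes ijk: "distinct [i, j, k]" and c: "c i - c j = 2" "c j - c k = -1" shows "\<not> is_weight c"
proof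
  assume "is_weight c"
  then have "is_weight (\<lambda>x. - 2 * c x) \<or> is_weight (\<lambda>x. - c x - single j (-2) x)
      \<or> is_weight (\<lambda>x. - 2 * single j (-2) x)"
    by (rule weight_of_distinct_pair[where i = i and j = k, OF _ weight_neg2]) (use ijk c in \<open>auto simp: single_def\<close>)
  moreover have "c i = c k + 1" "c j = c k - 1" using c by auto
  ultimately show False
    using ijk not_weight by (auto simp: wnorm_eq[OF ijk] single_def)
qed

text \<open>The candidates are 2 eps_i, eps_i + 2 eps_j and 4 eps_j. Modulo constants the second is
  the root eps_j - eps_k, so the two preceding lemmas and the norm bound exclude all three.\<close>

lemma not_weight_neg1:
  assumes ijk: "distinct [i, j, k]" shows "\<not> is_weight (single i (-1))"
proof
  assume "is_weight (single i (-1))"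
  then have "is_weight (\<lambda>x. - 2 * single i (-1) x) \<or> is_weight (\<lambda>x. - single i (-1) x - single j (-2) x)
      \<or> is_weight (\<lambda>x. - 2 * single j (-2) x)"
    by (rule weight_of_distinct_pair[where i = i and j = k, OF _ weight_neg2]) (use ijk in \<open>auto simp: single_def\<close>)
  moreover have "(\<lambda>x. - 2 * single i (-1) x) = single i 2" by (auto simp: single_def)
  moreover have "\<not> is_weight (\<lambda>x. - single i (-1) x - single j (-2) x)"
    by (rule not_weight_root[of j k i]) (use ijk in \<open>auto simp: single_def\<close>)
  ultimately show False
    using ijk not_weight not_weight_2[OF ijk] by (auto simp: wnorm_eq[OF ijk] single_def)
qed

text \<open>In decreasing order the differences p, q satisfy p^2 + pq + q^2 <= 4, which leaves six
  pairs. Of these (0,1), (1,1) and (2,0) are -eps_k, the root eps_i - eps_k and 2 eps_i, already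
  excluded.\<close>

lemma weights:
  assumes "is_weight c"
  shows "\<exists>k m. (m = 0 \<or> m = 1 \<or> m = -2) \<and> (\<forall>x y. c x - c y = single k m x - single k m y)"
proof -
  have "\<exists>i j k. distinct [i, j, k] \<and> c i \<ge> c j \<and> c j \<ge> c k"
  proof -
    obtain i j k :: 3 where ijk: "distinct [i, j, k]" using ex_distinct_3 by blast
    then show ?thesis
      by (metis distinct_length_2_or_more distinct_singleton linorder_le_cases)
  qed
  then obtain i j k where ijk: "distinct [i, j, k]" and le: "c i \<ge> c j" "c j \<ge> c k" by blast
  define p q where "p = c i - c j" and "q = c j - c k"
  have pq: "p \<ge> 0" "q \<ge> 0" using le by (auto simp: p_def q_def)
  have "wnorm c \<le> 16" using not_weight assms by force
  moreover have "wnorm c = 4 * (p * p + p * q + q * q)"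
    by (simp add: wnorm_eq[OF ijk] p_def q_def power2_eq_square algebra_simps)
  ultimately have le4: "p * p + p * q + q * q \<le> 4" by simp
  have "p < 3"
  proof (rule ccontr)
    assume "\<not> p < 3"
    then have "3 * 3 \<le> p * p" by (intro mult_mono) auto
    then show False using le4 pq by (smt (verit) mult_nonneg_nonneg)
  qed
  moreover have "q < 3"
  proof (rule ccontr)
    assume "\<not> q < 3"
    then have "3 * 3 \<le> q * q" by (intro mult_mono) auto
    then show False using le4 pq by (smt (verit) mult_nonneg_nonneg)
  qed
  ultimately have "(p = 0 \<or> p = 1 \<or> p = 2) \<and> (q = 0 \<or> q = 1 \<or> q = 2)" using pq by auto
  then have cases: "(p, q) \<in> {(0, 0), (1, 0), (0, 1), (1, 1), (2, 0), (0, 2)}" using le4 by auto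
  have cw: "is_weight (single x m)" if "c i - c j = single x m i - single x m j"
    "c j - c k = single x m j - single x m k" for x m
    using is_weight_cong[OF ijk that] assms by simp
  have "(p, q) \<noteq> (0, 1)"
    using cw[of k "-1"] not_weight_neg1[of k i j] ijk by (auto simp: p_def q_def single_def)
  moreover have "(p, q) \<noteq> (1, 1)"
    using not_weight_root[of i k j c] assms ijk by (auto simp: p_def q_def)
  moreover have "(p, q) \<noteq> (2, 0)"
    using cw[of i 2] not_weight_2[OF ijk] ijk by (auto simp: p_def q_def single_def)
  ultimately consider "p = 0" "q = 0" | "p = 1" "q = 0" | "p = 0" "q = 2" using cases by auto
  then have "\<exists>l m. (m = 0 \<or> m = 1 \<or> m = -2) \<and> c i - c j = single l m i - single l m j
      \<and> c j - c k = single l m j - single l m k"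
  proof cases
    case 1
    then show ?thesis by (intro exI[of _ i] exI[of _ 0]) (auto simp: p_def q_def single_def)
  next
    case 2
    then show ?thesis using ijk by (intro exI[of _ i] exI[of _ 1]) (auto simp: p_def q_def single_def)
  next
    case 3
    then show ?thesis using ijk by (intro exI[of _ k] exI[of _ "-2"]) (auto simp: p_def q_def single_def)
  qed
  then obtain l m where lm: "m = 0 \<or> m = 1 \<or> m = -2" "c i - c j = single l m i - single l m j"
    "c j - c k = single l m j - single l m k" by blast
  have "c x - c y = single l m x - single l m y" for x y
    using exhaust_distinct_3[OF ijk, of x] exhaust_distinct_3[OF ijk, of y] lm(2,3)
    by (elim disjE) simp_all
  then show ?thesis using lm(1) by blast
qed

text \<open>Both vectors have the same weight, so the only candidate is 4 eps_j, of norm 64.\<close>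

lemma neg2_one_dim:
  assumes "a \<in> Wt (single j (-2))" "b \<in> Wt (single j (-2))"
  shows "\<not> lin_indep2 a b"
proof
  assume "lin_indep2 a b"
  then have "is_weight (\<lambda>x. - 2 * single j (-2) x)" using weight_of_independent_pair[OF assms] by auto
  moreover have "(\<lambda>x. - 2 * single j (-2) x) = single j 4" by (auto simp: single_def)
  ultimately show False using not_weight[of "single j 4"] by (simp add: wnorm_single)
qed

end

section \<open>Representations with weights -2e, e and 0\<close>

text \<open>The scalars act properly only on K, so bases are handled as families in K. It serves
  twice: for the complex structure that \<open>h i j\<close> induces on a part of a weight space,
  and for real scalars on the space of weight 0.\<close>

lemma exists_module_basis:
  fixes act :: "'s::real_field \<Rightarrow> 'w::euclidean_space \<Rightarrow> 'w"
  assumes K: "0 \<in> K" "\<And>x y. x \<in> K \<Longrightarrow> y \<in> K \<Longrightarrow> x + y \<in> K" "\<And>a x. x \<in> K \<Longrightarrow> act a x \<in> K"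
    and act: "\<And>a x y. x \<in> K \<Longrightarrow> y \<in> K \<Longrightarrow> act a (x + y) = act a x + act a y"
      "\<And>a b x. x \<in> K \<Longrightarrow> act a (act b x) = act (a * b) x"
      "\<And>r x. x \<in> K \<Longrightarrow> act (of_real r) x = r *\<^sub>R x"
  shows "\<exists>(n::nat) v. (\<forall>m<n. v m \<in> K) \<and> (\<forall>a. (\<Sum>m<n. act (a m) (v m)) = 0 \<longrightarrow> (\<forall>m<n. a m = 0))
    \<and> (\<forall>y\<in>K. \<exists>a. y = (\<Sum>m<n. act (a m) (v m)))"
proof -
  define Q where "Q n \<longleftrightarrow> (\<exists>v :: nat \<Rightarrow> 'w. (\<forall>m<n. v m \<in> K) \<and>
    (\<forall>a. (\<Sum>m<n. act (a m) (v m)) = 0 \<longrightarrow> (\<forall>m<n. a m = 0)))" for n :: nat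
  have act0: "act 0 x = 0" and act1: "act 1 x = x" if "x \<in> K" for x
    using act(3)[OF that, of 0] act(3)[OF that, of 1] by auto
  have actz: "act a 0 = 0" for a
    using act(1)[OF K(1) K(1), of a] by simp
  have sumK: "(\<Sum>m<n. f m) \<in> K" if "\<And>m. m < n \<Longrightarrow> f m \<in> K" for n and f :: "nat \<Rightarrow> 'w"
    using that by (induction n) (auto intro: K)
  have act_sum: "act a (\<Sum>m<n. f m) = (\<Sum>m<n. act a (f m))" if "\<And>m. m < n \<Longrightarrow> f m \<in> K"
    for a n and f :: "nat \<Rightarrow> 'w"
    using that by (induction n) (auto simp: actz act sumK)
  have "Q 0" by (simp add: Q_def)
  moreover have "n \<le> DIM('w)" if "Q n" for n
  proof (rule ccontr)
    assume big: "\<not> n \<le> DIM('w)"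
    obtain v where "(\<forall>m<n. v m \<in> K) \<and> (\<forall>a. (\<Sum>m<n. act (a m) (v m)) = 0 \<longrightarrow> (\<forall>m<n. a m = 0))"
      using \<open>Q n\<close> unfolding Q_def ..
    then have v: "\<And>m. m < n \<Longrightarrow> v m \<in> K"
      "\<And>a. (\<Sum>m<n. act (a m) (v m)) = 0 \<Longrightarrow> \<forall>m<n. a m = 0"
      by simp_all
    obtain c where c: "\<exists>i\<le>DIM('w). c i \<noteq> 0" "(\<Sum>i\<le>DIM('w). c i *\<^sub>R v i) = 0"
      using finite_family_dependent by blast
    \<comment> \<open>A real dependence among the first members, extended by zero, is a dependence
      over the larger field; this bounds the length of independent families.\<close>
    let ?a = "\<lambda>m. of_real (if m \<le> DIM('w) then c m else 0) :: 's"
    have "(\<Sum>m<n. act (?a m) (v m)) = (\<Sum>m<n. (if m \<le> DIM('w) then c m else 0) *\<^sub>R v m)"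
      by (intro sum.cong refl act(3) v) auto
    also have "\<dots> = (\<Sum>i\<le>DIM('w). c i *\<^sub>R v i)"
      using big by (intro sum.mono_neutral_cong_right) auto
    finally have "\<forall>m<n. ?a m = 0" using v(2)[of ?a] c(2) by simp
    moreover obtain i where i: "i \<le> DIM('w)" "c i \<noteq> 0" using c(1) by blast
    moreover have "i < n" using i(1) big by simp
    ultimately have "?a i = 0" by blast
    then show False using i by simp
  qed
  ultimately obtain n where n: "Q n" "\<not> Q (Suc n)"
    by (metis Suc_n_not_le_n nat_induct)
  obtain v where "(\<forall>m<n. v m \<in> K) \<and> (\<forall>a. (\<Sum>m<n. act (a m) (v m)) = 0 \<longrightarrow> (\<forall>m<n. a m = 0))"
    using n(1) unfolding Q_def ..
  then have v: "\<And>m. m < n \<Longrightarrow> v m \<in> K"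
    "\<And>a. (\<Sum>m<n. act (a m) (v m)) = 0 \<Longrightarrow> \<forall>m<n. a m = 0"
    by simp_all
  have span: "\<exists>a. y = (\<Sum>m<n. act (a m) (v m))" if y: "y \<in> K" for y
  proof (rule ccontr)
    assume none: "\<nexists>a. y = (\<Sum>m<n. act (a m) (v m))"
    define v' where "v' = v(n := y)"
    have "\<forall>m<Suc n. a m = 0" if a: "(\<Sum>m<Suc n. act (a m) (v' m)) = 0" for a
    proof -
      let ?s = "\<Sum>m<n. act (a m) (v m)"
      have "(\<Sum>m<n. act (a m) (v' m)) = ?s" by (rule sum.cong) (auto simp: v'_def)
      with a have sum: "?s + act (a n) y = 0" by (simp add: v'_def)
      have "a n = 0"
      proof (rule ccontr)
        assume an: "a n \<noteq> 0"
        have sK: "?s \<in> K" using v K by (intro sumK) auto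
        have "0 = act (- 1 / a n) (?s + act (a n) y)" by (simp add: sum actz)
        also have "\<dots> = act (- 1 / a n) ?s + act (- 1) y"
          using sK y K an by (simp add: act)
        also have "act (- 1) y = - y" using act(3)[OF y, of "-1"] by simp
        also have "act (- 1 / a n) ?s = (\<Sum>m<n. act (- 1 / a n) (act (a m) (v m)))"
          by (rule act_sum) (use v K in auto)
        also have "\<dots> = (\<Sum>m<n. act (- a m / a n) (v m))"
          by (rule sum.cong) (auto simp: act v)
        finally have "y = (\<Sum>m<n. act (- a m / a n) (v m))" by simp
        then show False using none exI[of "\<lambda>a. y = (\<Sum>m<n. act (a m) (v m))" "\<lambda>m. - a m / a n"]
          by (elim notE) simp
      qed
      moreover from this have "\<forall>m<n. a m = 0" using sum y act0 by (intro v) simp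
      ultimately show ?thesis by (simp add: less_Suc_eq)
    qed
    moreover have "\<forall>m<Suc n. v' m \<in> K" using v y by (auto simp: v'_def less_Suc_eq)
    ultimately have "Q (Suc n)" unfolding Q_def by blast
    then show False using n by blast
  qed
  show ?thesis
  proof (rule exI[of _ n], rule exI[of _ v], intro conjI)
    show "\<forall>m<n. v m \<in> K" using v(1) by simp
    show "\<forall>a. (\<Sum>m<n. act (a m) (v m)) = 0 \<longrightarrow> (\<forall>m<n. a m = 0)"
      using v(2) by simp
    show "\<forall>y\<in>K. \<exists>a. y = (\<Sum>m<n. act (a m) (v m))" using span by (rule ballI)
  qed
qed

text \<open>All that is retained of the wedge product: the list of weights and multiplicity
  one.\<close>

locale sl3_her = sl3_rep +
  assumes weights: "is_weight c \<Longrightarrow>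
      \<exists>k m. (m = 0 \<or> m = 1 \<or> m = -2) \<and> (\<forall>x y. c x - c y = single k m x - single k m y)"
    and weight_neg2: "is_weight (single j (-2))"
    and neg2_one_dim: "a \<in> Wt (single j (-2)) \<Longrightarrow> b \<in> Wt (single j (-2)) \<Longrightarrow> \<not> lin_indep2 a b"
begin

text \<open>The seven pairs are the differences of 0, of the three eps and of the three -2
  eps.\<close>

lemma zero_by_weight:
  assumes "distinct [i, j, k]" "v \<in> Wt c"
    "(c i - c j, c j - c k) \<notin> {(0,0), (1,0), (-1,1), (0,-1), (-2,0), (2,-2), (0,2)}"
  shows "v = 0"
proof (rule not_weight_zero[OF assms(2)], rule notI)
  assume "is_weight c"
  then obtain l m where m: "m = 0 \<or> m = 1 \<or> m = -2"
    "\<And>x y. c x - c y = single l m x - single l m y" using weights by blast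
  have "(c i - c j, c j - c k) = (single l m i - single l m j, single l m j - single l m k)"
    using m(2) by blast
  then show False
    using assms(3) m(1) exhaust_distinct_3[OF assms(1), of l] distinct_3D[OF assms(1)]
    by (elim disjE) (simp_all add: single_def)
qed

abbreviation N :: "3 \<Rightarrow> 'a set" where "N k \<equiv> Wt (single k (-2))"
abbreviation P :: "3 \<Rightarrow> 'a set" where "P k \<equiv> Wt (single k 1)"
abbreviation Z :: "'a set" where "Z \<equiv> Wt (\<lambda>_. 0)"

lemma N_kill:
  assumes "v \<in> N i" "k \<noteq> i" "k \<noteq> l" shows "u k l a v = 0"
proof -
  obtain m where ikm: "distinct [i, k, m]" using ex_third assms(2) by metis
  show ?thesis
    by (rule zero_by_weight[OF ikm Wt_u[OF assms(1,3)]])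
       (use distinct_3D[OF ikm] assms(3) exhaust_distinct_3[OF ikm, of l] in \<open>auto simp: shift_def single_def\<close>)
qed

text \<open>Modulo constants -eps_i - eps_j equals eps_k.\<close>

lemma N_P:
  assumes "v \<in> N i" "distinct [i, j, k]" shows "u i j a v \<in> P k"
  by (rule Wt_mono[OF Wt_u[OF assms(1), of i j a] assms(2)])
     (use distinct_3D[OF assms(2)] in \<open>auto simp: shift_def single_def\<close>)

lemma P_N:
  assumes "v \<in> P k" "distinct [i, j, k]" shows "u i j a v \<in> N j"
  by (rule Wt_mono[OF Wt_u[OF assms(1), of i j a] assms(2)])
     (use distinct_3D[OF assms(2)] in \<open>auto simp: shift_def single_def\<close>)

lemma P_P:
  assumes "v \<in> P k" "j \<noteq> k" shows "u j k a v \<in> P j"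
proof -
  obtain i where jki: "distinct [j, k, i]" using ex_third assms(2) by metis
  show ?thesis
    by (rule Wt_mono[OF Wt_u[OF assms(1), of j k a] jki])
       (use distinct_3D[OF jki] in \<open>auto simp: shift_def single_def\<close>)
qed

lemma P_kill:
  assumes "v \<in> P k" "k \<noteq> j" shows "u k j a v = 0"
proof -
  obtain i where jki: "distinct [k, j, i]" using ex_third assms(2) by metis
  show ?thesis
    by (rule zero_by_weight[OF jki Wt_u[OF assms(1), of k j a]])
       (use distinct_3D[OF jki] in \<open>auto simp: shift_def single_def\<close>)
qed

lemma Z_kill:
  assumes "v \<in> Z" "k \<noteq> j" shows "u k j a v = 0"
proof -
  obtain i where jki: "distinct [k, j, i]" using ex_third assms(2) by metis
  show ?thesis
    by (rule zero_by_weight[OF jki Wt_u[OF assms(1), of k j a]])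
       (use distinct_3D[OF jki] in \<open>auto simp: shift_def\<close>)
qed

text \<open>The opposite root vector kills v, so applying it after \<open>u j k a\<close> returns
  \<open>h k j 1 v\<close>, which is 2 v.\<close>

lemma N_inj:
  assumes "v \<in> N j" "j \<noteq> k" "a \<noteq> 0" "u j k a v = 0" shows "v = 0"
proof -
  have "u k j (inverse a) (u j k a v) = u j k a (u k j (inverse a) v) + h k j (inverse a * a) v"
    using assms(2) by (intro u_u_opposite) auto
  then have "h k j 1 v = 0"
    using assms N_kill[OF assms(1), of k j] by (simp add: u_arg)
  then show ?thesis using Wt_h[OF assms(1), of k j] assms(2) by (simp add: single_def)
qed

lemma N_multiple:
  assumes "w \<in> N j" "w \<noteq> 0" "v \<in> N j" shows "\<exists>r. v = r *\<^sub>R w"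
proof -
  obtain r s where rs: "r *\<^sub>R v + s *\<^sub>R w = 0" "r \<noteq> 0 \<or> s \<noteq> 0"
    using neg2_one_dim[OF assms(3,1)] unfolding lin_indep2_def by blast
  have "r \<noteq> 0" using rs assms(2) by auto
  moreover have "r *\<^sub>R v = (- s) *\<^sub>R w" using rs(1) by (simp add: add_eq_0_iff2)
  ultimately have "v = (- s / r) *\<^sub>R w"
    by (metis (no_types, lifting) divide_inverse_commute scaleR_one scaleR_scaleR left_inverse)
  then show ?thesis by blast
qed

lemma u_split: "i \<noteq> j \<Longrightarrow> u i j a v = Re a *\<^sub>R u i j 1 v + Im a *\<^sub>R u i j \<i> v"
  using u_coeff(1)[of i j "of_real (Re a) * 1" "of_real (Im a) * \<i>" v]
    u_coeff(2)[of i j "Re a" 1 v] u_coeff(2)[of i j "Im a" \<i> v]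
  by (simp add: complex_eq[of a, symmetric] mult.commute)

lemma h_split: "h i j a v = Re a *\<^sub>R h i j 1 v + Im a *\<^sub>R h i j \<i> v"
  using h_coeff(1)[of i j "of_real (Re a) * 1" "of_real (Im a) * \<i>" v]
    h_coeff(2)[of i j "Re a" 1 v] h_coeff(2)[of i j "Im a" \<i> v]
  by (simp add: complex_eq[of a, symmetric] mult.commute)

text \<open>Both \<open>N i\<close> and \<open>N j\<close> are real lines, so \<open>h i j \<i>\<close> acts on them by real scalars \<open>s\<close> and \<open>t\<close>.
  Applying it to \<open>X X w\<close>, \<open>X Y w\<close>, \<open>Y Y w\<close> forces \<open>s = t\<close>, \<open>X Y w = 0\<close> and \<open>Y Y w = X X w\<close>.\<close>
lemma N_relations:
  assumes w: "w \<in> N i" and ij: "i \<noteq> j"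
  shows "h i j \<i> w = 0" "u i j a (u i j b w) = Re (a * cnj b) *\<^sub>R u i j 1 (u i j 1 w)"
proof -
  have "h i j \<i> w = 0 \<and> u i j 1 (u i j \<i> w) = 0 \<and> u i j \<i> (u i j \<i> w) = u i j 1 (u i j 1 w)"
  proof (cases "w = 0")
    case True
    then show ?thesis using ij by (simp add: u_arg)
  next
    case False
    obtain k where ijk: "distinct [i, j, k]" using ex_third ij by blast
    let ?X = "u i j 1" and ?Y = "u i j \<i>" and ?h = "h i j \<i>"
    let ?x = "?X (?X w)"
    have mem: "u i j a (u i j b w) \<in> N j" for a b by (rule P_N[OF N_P[OF w ijk] ijk])
    have nz: "?x \<noteq> 0"
    proof -
      have "(u i j 1 ^^ 2) w \<noteq> 0"
      proof (rule sl2_string_nonzero[OF sl2[of j i]])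
        show "u j i 1 w = 0" using N_kill[OF w] ij by auto
        show "h j i 1 w = real 2 *\<^sub>R w" using Wt_h[OF w, of j i] ij by (simp add: single_def)
      qed (use ij False in auto)
      then show ?thesis by (simp add: numeral_2_eq_2)
    qed
    obtain s where s: "?h w = s *\<^sub>R w" using N_multiple[OF w False Wt_h_closed[OF w]] by blast
    obtain t where t: "?h ?x = t *\<^sub>R ?x" using N_multiple[OF mem nz Wt_h_closed[OF mem]] by blast
    obtain c where c: "?X (?Y w) = c *\<^sub>R ?x" using N_multiple[OF mem nz mem] by blast
    obtain d where d: "?Y (?Y w) = d *\<^sub>R ?x" using N_multiple[OF mem nz mem] by blast
    have two: "u i j (2 * a) v = 2 *\<^sub>R u i j a v" for a v using u_coeff(2)[OF ij, of 2 a v] by simp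
    have hX: "?h (?X v) = ?X (?h v) + 2 *\<^sub>R ?Y v" for v
      using h_u[OF ij, of i j \<i> 1 v] ij two[of \<i>] by (simp add: root_value_def mult.commute)
    have hY: "?h (?Y v) = ?Y (?h v) - 2 *\<^sub>R ?X v" for v
      using h_u[OF ij, of i j \<i> \<i> v] ij two[of 1 v] u_coeff(3)[OF ij, of 2 v] by (simp add: root_value_def)
    have comm: "?Y (?X v) = ?X (?Y v)" for v using ij by (intro u_u_commute) auto
    note uarg = u_arg[OF ij]
    have "?h ?x = (4 * c + s) *\<^sub>R ?x"
      by (simp add: hX uarg s comm c algebra_simps scaleR_4 flip: scaleR_2)
    then have e1: "t = 4 * c + s" using t nz by simp
    have "?h (?X (?Y w)) = (2 * d - 2 + s * c) *\<^sub>R ?x"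
      by (simp only: hX hY) (simp add: uarg s comm c d algebra_simps)
    then have e2: "t * c = 2 * d - 2 + s * c" using t nz by (simp add: c) (simp add: mult.commute)
    have "?h (?Y (?Y w)) = (s * d - 4 * c) *\<^sub>R ?x"
      by (simp only: hY, simp add: uarg s comm c d algebra_simps, simp flip: scaleR_add_left)
    then have e3: "t * d = s * d - 4 * c" using t nz by (simp add: d) (simp add: mult.commute)
    \<comment> \<open>Eliminating t between e1 and e3 gives this; d = -1 would turn e2 into c^2 =
      -1, impossible over the reals.\<close>
    have "c * (d + 1) = 0" using e1 e3 by (simp add: algebra_simps)
    moreover have "d \<noteq> - 1"
    proof
      assume "d = - 1"
      then have "c * c = - 1" using e1 e2 by (simp add: algebra_simps)
      then show False using zero_le_square[of c] by linarith
    qed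
    ultimately have c0: "c = 0" by simp
    then have d1: "d = 1" using e1 e2 by simp
    have kill: "u j i a w = 0" for a using N_kill[OF w] ij by auto
    \<comment> \<open>So far only s = t is known. Applying the opposite root vector to ?X (?Y w) = 0
      returns - s ?X w, whence s = 0.\<close>
    have "0 = u j i 1 (?X (?Y w))" using ij by (simp add: c c0 u_arg)
    also have "\<dots> = ?X (u j i 1 (?Y w)) + h j i 1 (?Y w)"
      using u_u_opposite[of j i 1 1 "?Y w"] ij by simp
    also have "h j i 1 (?Y w) = 0"
      using Wt_h[OF N_P[OF w ijk, of \<i>], of j i] distinct_3D[OF ijk] by (simp add: single_def)
    also have "u j i 1 (?Y w) = - (s *\<^sub>R w)"
      using u_u_opposite[of j i 1 \<i> w] ij h_swap[of j i \<i> w] by (simp add: kill u_arg s)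
    finally have "s *\<^sub>R ?X w = 0" by (simp add: uarg)
    moreover have "?X w \<noteq> 0" using nz uarg by auto
    ultimately have "s = 0" by simp
    then show ?thesis using s c d c0 d1 by simp
  qed
  note rel = this
  then show "h i j \<i> w = 0" by simp
  have "u i j \<i> (u i j 1 w) = u i j 1 (u i j \<i> w)" using ij by (intro u_u_commute) auto
  then show "u i j a (u i j b w) = Re (a * cnj b) *\<^sub>R u i j 1 (u i j 1 w)"
    using rel unfolding u_split[OF ij, of a] u_split[OF ij, of b]
    by (simp add: u_arg[OF ij] algebra_simps)
qed

lemma N_h: "w \<in> N i \<Longrightarrow> i \<noteq> j \<Longrightarrow> h i j a w = (- 2 * Re a) *\<^sub>R w"
  using N_relations(1)[of w i j] Wt_h[of w _ i j]
  by (subst h_split) (simp add: single_def)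

end

section \<open>Hermitian matrices and the action on them\<close>

lemma adj_mat_add: "adj_mat (X + Y) = adj_mat X + adj_mat Y"
  by (simp add: adj_mat_def vec_eq_iff)

lemma adj_mat_diff: "adj_mat (X - Y) = adj_mat X - adj_mat Y"
  by (simp add: adj_mat_def vec_eq_iff)

lemma adj_mat_minus: "adj_mat (- X) = - adj_mat X"
  by (simp add: adj_mat_def vec_eq_iff)

lemma adj_mat_adj_mat: "adj_mat (adj_mat X) = X"
  by (simp add: adj_mat_def vec_eq_iff)

lemma adj_mat_mult: "adj_mat (X ** Y) = adj_mat Y ** adj_mat X"
  by (simp add: adj_mat_def vec_eq_iff matrix_matrix_mult_def mult.commute)

lemma adj_mat_mat_unit: "adj_mat (mat_unit i j a) = mat_unit j i (cnj a)"
  by (auto simp: adj_mat_def vec_eq_iff mat_unit_nth)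

lemma hermitian_her_action: "hermitian H \<Longrightarrow> hermitian (her_action X H)"
  by (simp add: hermitian_def her_action_def adj_mat_minus adj_mat_diff adj_mat_mult adj_mat_adj_mat)

lemma matrix_add_rdistrib: "(A + B) ** C = A ** C + B ** (C :: 'a::ring_1^'n^'m)"
  by (simp add: vec_eq_iff matrix_matrix_mult_def sum.distrib algebra_simps)

lemma her_action_add: "her_action (X + Y) H = her_action X H + her_action Y H"
  by (simp add: her_action_def adj_mat_add matrix_add_rdistrib matrix_add_ldistrib)

lemma matrix_minus_left: "(- A) ** B = - (A ** (B :: 'a::ring_1^'n^'m))"
  using matrix_diff_rdistrib[of 0 A B] by simp

lemma matrix_minus_right: "A ** (- B) = - (A ** (B :: 'a::ring_1^'n^'m))"
  using matrix_diff_ldistrib[of A 0 B] by simp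

lemma her_action_bracket:
  "her_action (lie_bracket X Y) H = her_action X (her_action Y H) - her_action Y (her_action X H)"
  by (simp add: her_action_def lie_bracket_def adj_mat_diff adj_mat_mult matrix_add_rdistrib
      matrix_add_ldistrib matrix_diff_ldistrib matrix_diff_rdistrib matrix_minus_left
      matrix_minus_right matrix_mul_assoc)

lemma mat_unit_mult_left_nth: "(mat_unit i j a ** H) $ p $ q = (if p = i then a * H $ j $ q else 0)"
proof -
  have "(\<Sum>k\<in>UNIV. (if p = i \<and> k = j then a else 0) * H $ k $ q)
      = (\<Sum>k\<in>UNIV. if k = j then (if p = i then a * H $ j $ q else 0) else 0)"
    by (rule sum.cong) auto
  then show ?thesis by (simp add: matrix_matrix_mult_def mat_unit_nth)
qed

lemma mat_unit_mult_right_nth: "(H ** mat_unit i j a) $ p $ q = (if q = j then H $ p $ i * a else 0)"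
proof -
  have "(\<Sum>k\<in>UNIV. H $ p $ k * (if k = i \<and> q = j then a else 0))
      = (\<Sum>k\<in>UNIV. if k = i then (if q = j then H $ p $ i * a else 0) else 0)"
    by (rule sum.cong) auto
  then show ?thesis by (simp add: matrix_matrix_mult_def mat_unit_nth)
qed

lemma her_action_mat_unit_nth:
  "her_action (mat_unit i j a) H $ p $ q
    = - ((if p = j then cnj a * H $ i $ q else 0) + (if q = j then H $ p $ i * a else 0))"
  by (simp add: her_action_def adj_mat_mat_unit mat_unit_mult_left_nth mat_unit_mult_right_nth)

lemma hermitian_nth: "hermitian H \<Longrightarrow> H $ q $ p = cnj (H $ p $ q)"
  by (auto simp: hermitian_def adj_mat_def vec_eq_iff)

lemma hermitian_diag: "hermitian H \<Longrightarrow> H $ p $ p = of_real (Re (H $ p $ p))"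
  using hermitian_nth[of H p p] by (simp add: complex_eq_iff)

lemma mat_unit_vector_nth: "(mat_unit i j a *v x) $ p = (if p = i then a * x $ j else 0)"
proof -
  have "(\<Sum>k\<in>UNIV. (if p = i \<and> k = j then a else 0) * x $ k)
      = (\<Sum>k\<in>UNIV. if k = j then (if p = i then a * x $ j else 0) else 0)"
    by (rule sum.cong) auto
  then show ?thesis by (simp add: matrix_vector_mult_def mat_unit_nth)
qed

section \<open>The frame of Her and the copies of E\<close>

context sl3_her
begin

text \<open>\<open>w i\<close> is to become the diagonal form at i. In Her the unit at (i, j),
  applied twice, sends the i-th diagonal form to twice the j-th, which explains the factor 2. An
  off-diagonal form is reached from both of its ends, with conjugate entries.\<close>

lemma exists_her_frame:
  "\<exists>w. (\<forall>i. w i \<in> N i \<and> w i \<noteq> 0) \<and> (\<forall>i j. i \<noteq> j \<longrightarrow> u i j 1 (u i j 1 (w i)) = 2 *\<^sub>R w j)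
    \<and> (\<forall>i j a. i \<noteq> j \<longrightarrow> u i j a (w i) = u j i (cnj a) (w j))"
proof -
  obtain o1 o2 o3 :: 3 where o3: "distinct [o1, o2, o3]" using ex_distinct_3 by blast
  obtain w0 where w0: "w0 \<in> N o1" "w0 \<noteq> 0" using weight_neg2[of o1] by (auto simp: is_weight_def)
  define w where "w j = (if j = o1 then w0 else (1/2) *\<^sub>R u o1 j 1 (u o1 j 1 w0))" for j
  have wN: "w j \<in> N j" for j
  proof (cases "j = o1")
    case False
    then obtain k where ijk: "distinct [o1, j, k]" using ex_third by metis
    show ?thesis using False P_N[OF N_P[OF w0(1) ijk] ijk] by (simp add: w_def Wt_closed)
  qed (simp add: w_def w0)
  \<comment> \<open>Needs only the square relation from i to j: \<open>u j i b\<close> is moved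
    inward through both factors until it kills \<open>w i\<close>.\<close>
  have symm: "u j i b (w j) = u i j (cnj b) (w i)"
    if ij: "i \<noteq> j" and sq: "u i j 1 (u i j 1 (w i)) = 2 *\<^sub>R w j" for i j b
  proof -
    let ?v = "w i"
    note uarg = u_arg[OF ij]
    have comm: "u j i b (u i j 1 v) = u i j 1 (u j i b v) + h j i b v" for v
      using u_u_opposite[of j i b 1 v] ij by simp
    have kill: "u j i b ?v = 0" using N_kill[OF wN] ij by auto
    have hv: "h j i b ?v = (2 * Re b) *\<^sub>R ?v"
      using N_h[OF wN ij, of b] h_swap[of j i b ?v] by simp
    have two: "u i j (2 * b) ?v = 2 *\<^sub>R u i j b ?v" using u_coeff(2)[OF ij, of 2 b ?v] by simp
    have hX: "h j i b (u i j 1 ?v) = (2 * Re b) *\<^sub>R u i j 1 ?v - 2 *\<^sub>R u i j b ?v"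
      using h_u[OF ij, of j i b 1 ?v] ij two u_coeff(3)[OF ij, of "2 * b" ?v]
      by (simp add: root_value_def hv uarg mult.commute)
    have "2 *\<^sub>R u j i b (w j) = u j i b (u i j 1 (u i j 1 ?v))"
      using ij by (simp add: sq u_arg)
    also have "\<dots> = 2 *\<^sub>R ((2 * Re b) *\<^sub>R u i j 1 ?v - u i j b ?v)"
      by (simp add: comm kill hv hX uarg algebra_simps) (simp flip: scaleR_add_left)
    also have "(2 * Re b) *\<^sub>R u i j 1 ?v - u i j b ?v = u i j (cnj b) ?v"
      unfolding u_split[OF ij, of b] u_split[OF ij, of "cnj b"]
      by (simp add: algebra_simps flip: scaleR_2 scaleR_add_left)
    finally show ?thesis by simp
  qed
  have sq1: "u o1 j 1 (u o1 j 1 (w o1)) = 2 *\<^sub>R w j" if "j \<noteq> o1" for j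
    using that by (simp add: w_def)
  have sq2: "u j o1 1 (u j o1 1 (w j)) = 2 *\<^sub>R w o1" if j: "j \<noteq> o1" for j
  proof -
    have "u j o1 1 (u j o1 1 (w j)) = u j o1 1 (u o1 j 1 (w o1))"
      using symm[of o1 j 1] sq1[OF j] j by simp
    also have "\<dots> = h j o1 1 (w o1)"
      using u_u_opposite[OF j, of 1 1 "w o1"] N_kill[OF wN[of o1] j j] j by (simp add: u_arg)
    also have "\<dots> = 2 *\<^sub>R w o1" using Wt_h[OF wN[of o1], of j o1] j by (simp add: single_def)
    finally show ?thesis .
  qed
  \<comment> \<open>On its way to \<open>w0\<close>, which it kills, each ?C turns one factor ?A
    into - ?B; two of them turn the double ?A into 2 ?B ?B.\<close>
  have sq3: "u j k 1 (u j k 1 (w j)) = 2 *\<^sub>R w k" if "distinct [o1, j, k]" for j k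
  proof -
    note d = distinct_3D[OF that]
    let ?A = "u o1 j 1" and ?B = "u o1 k 1" and ?C = "u j k 1"
    have arg: "?A (- v) = - ?A v" "?A 0 = 0" "?B (- v) = - ?B v" "?B 0 = 0" "?C (- v) = - ?C v"
      "?C (r *\<^sub>R v) = r *\<^sub>R ?C v" "?C (v - v') = ?C v - ?C v'" for v v' r
      using d by (auto simp: u_arg)
    have CA: "?C (?A v) = ?A (?C v) - ?B v" for v
      using u_u_chain'[of j k o1 1 1 v] d by simp
    have CB: "?C (?B v) = ?B (?C v)" for v using d by (intro u_u_commute) auto
    have AB: "?A (?B v) = ?B (?A v)" for v using d by (intro u_u_commute) auto
    have C0: "?C w0 = 0" using N_kill[OF w0(1)] d by auto
    have "?C (?C (w j)) = (1/2) *\<^sub>R ?C (?C (?A (?A w0)))"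
      using d by (simp add: w_def arg)
    also have "?C (?C (?A (?A w0))) = 2 *\<^sub>R ?B (?B w0)"
      by (simp add: CA CB AB C0 arg scaleR_2)
    also have "(1/2) *\<^sub>R (2 *\<^sub>R ?B (?B w0)) = 2 *\<^sub>R w k"
      using d by (simp add: w_def)
    finally show ?thesis .
  qed
  have sq: "u i j 1 (u i j 1 (w i)) = 2 *\<^sub>R w j" if "i \<noteq> j" for i j
    using sq1[of j] sq2[of i] sq3[of i j] that by (cases "i = o1"; cases "j = o1") auto
  have "w j \<noteq> 0" for j
  proof (cases "j = o1")
    case False
    then show ?thesis using sq[of j o1] w0(2) by (auto simp: w_def u_arg)
  qed (simp add: w_def w0)
  then show ?thesis using wN sq symm[OF _ sq]
    by (intro exI[of _ w]) (metis complex_cnj_cnj)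
qed

text \<open>The intended complement in \<open>P k\<close> of the vectors
  \<open>u i j b (w i)\<close> of Her: what the root vectors leading from \<open>P k\<close> to the
  maximal weights annihilate.\<close>

definition K :: "3 \<Rightarrow> 'a set" where
  "K k = {y \<in> P k. \<forall>i j a. distinct [i, j, k] \<longrightarrow> u i j a y = 0}"

lemma K_P: "y \<in> K k \<Longrightarrow> y \<in> P k"
  by (simp add: K_def)

lemma K_kill: "y \<in> K k \<Longrightarrow> distinct [i, j, k] \<Longrightarrow> u i j a y = 0"
  by (simp add: K_def)

lemma K_closed: "0 \<in> K k" "x \<in> K k \<Longrightarrow> y \<in> K k \<Longrightarrow> x + y \<in> K k"
  "x \<in> K k \<Longrightarrow> y \<in> K k \<Longrightarrow> x - y \<in> K k" "x \<in> K k \<Longrightarrow> r *\<^sub>R x \<in> K k"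
  by (auto simp: K_def Wt_closed u_arg)

lemma K_h0:
  assumes "y \<in> K k" "distinct [i, j, k]" shows "h i j a y = 0"
  using u_u_opposite[of i j a 1 y] K_kill[OF assms] K_kill[OF assms(1), of j i] distinct_3D[OF assms(2)]
  by (simp add: u_arg)

lemma K_h:
  assumes "y \<in> K k" shows "h p q a y \<in> K k"
  unfolding K_def
proof (intro CollectI conjI allI impI)
  show "h p q a y \<in> P k" by (rule Wt_h_closed[OF K_P[OF assms]])
next
  fix i j b assume ijk: "distinct [i, j, k]"
  then have "i \<noteq> j" by simp
  then show "u i j b (h p q a y) = 0"
    using h_u[of i j p q a b y] K_kill[OF assms ijk] by simp
qed

lemma K_step:
  assumes y: "y \<in> K j" and ij: "i \<noteq> j" shows "u i j a y \<in> K i"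
proof -
  obtain k where ijk: "distinct [i, j, k]" using ex_third[OF ij] by blast
  note d = distinct_3D[OF ijk]
  let ?v = "u i j a y"
  have vP: "?v \<in> P i" by (rule P_P[OF K_P[OF y] ij])
  have jk: "u j k b ?v = 0" for b
    using u_u_chain'[of j k i b a y] d P_kill[OF K_P[OF y], of k] K_kill[OF y, of i k] by (simp add: u_arg)
  \<comment> \<open>\<open>u k j b\<close> lands in \<open>N j\<close>, where \<open>u j k\<close>
    is injective; and \<open>u j k\<close> kills the result because \<open>u j k\<close> and
    \<open>h j k 1\<close> both kill ?v.\<close>
  have kj: "u k j b ?v = 0" for b
  proof (cases "b = 0")
    case True
    then show ?thesis using d by (simp add: u_coeff)
  next
    case False
    show ?thesis
    proof (rule N_inj[of _ j k "inverse b"])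
      show "u k j b ?v \<in> N j" by (rule P_N[OF vP]) (use d in auto)
      have "h j k 1 ?v = 0" using Wt_h[OF vP, of j k] d by (simp add: single_def)
      then show "u j k (inverse b) (u k j b ?v) = 0"
        using u_u_opposite[of j k "inverse b" b ?v] d jk False by (simp add: u_arg)
    qed (use d False in auto)
  qed
  have "u p q b ?v = 0" if "distinct [p, q, i]" for p q b
    using exhaust_distinct_3[OF ijk, of p] exhaust_distinct_3[OF ijk, of q] that jk kj by auto
  then show ?thesis using vP by (simp add: K_def)
qed

lemma K_up: "y \<in> K i \<Longrightarrow> i \<noteq> j \<Longrightarrow> u i j a y = 0"
  by (rule P_kill[OF K_P])

lemma K_up_down: "y \<in> K i \<Longrightarrow> i \<noteq> j \<Longrightarrow> u i j b (u j i a y) = h i j (b * a) y"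
  using u_u_opposite[of i j b a y] K_up[of y i j b] by (simp add: u_arg)

lemma K_h_1: "y \<in> K i \<Longrightarrow> i \<noteq> j \<Longrightarrow> h i j 1 y = y"
  using Wt_h[OF K_P, of y i i j] by (simp add: single_def)

lemma K_down_up: "z \<in> K j \<Longrightarrow> i \<noteq> j \<Longrightarrow> u j i 1 (u i j 1 z) = z"
  using K_up_down[of z j i 1 1] K_h_1[of z j i] by simp

lemma K_inj: "z \<in> K j \<Longrightarrow> i \<noteq> j \<Longrightarrow> u i j 1 z = 0 \<Longrightarrow> z = 0"
  using K_down_up[of z j i] by (simp add: u_arg)

lemma K_h_third:
  assumes "y \<in> K i" "distinct [i, j, k]" shows "h i k a y = h i j a y"
  using h_trans[of i k a y j] K_h0[OF assms(1), of j k a] distinct_3D[OF assms(2)] by simp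

text \<open>No bracket gives products of torus elements. Instead, injectivity of
  \<open>u i j 1\<close> on \<open>K j\<close> identifies \<open>u j i \<i> y\<close> with
  \<open>u j i 1 (h i j \<i> y)\<close>, and going back up by \<open>u i j \<i>\<close> shows that
  \<open>h i j \<i>\<close> squares to -1.\<close>

lemma K_h_mult:
  assumes y: "y \<in> K i" and ij: "i \<noteq> j" shows "h i j a (h i j b y) = h i j (a * b) y"
proof -
  have ji: "j \<noteq> i" using ij by simp
  let ?J = "h i j \<i>"
  have Jy: "?J y \<in> K i" by (rule K_h[OF y])
  have "u j i \<i> y - u j i 1 (?J y) = 0"
  proof (rule K_inj[OF _ ij])
    show "u j i \<i> y - u j i 1 (?J y) \<in> K j" by (intro K_closed K_step y ji Jy)
    show "u i j 1 (u j i \<i> y - u j i 1 (?J y)) = 0"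
      using ij K_up_down[OF y ij] K_up_down[OF Jy ij] K_h_1[OF Jy ij] by (simp add: u_arg)
  qed
  then have "u i j \<i> (u j i \<i> y) = u i j \<i> (u j i 1 (?J y))" by simp
  then have JJ: "?J (?J y) = - y"
    using K_up_down[OF y ij] K_up_down[OF Jy ij] h_coeff(3)[of i j 1 y] K_h_1[OF y ij] by simp
  show ?thesis
    unfolding h_split[of i j a] h_split[of i j b] h_split[of i j "a * b"]
    by (simp add: K_h_1[OF y ij] K_h_1[OF Jy ij] JJ algebra_simps)
qed

text \<open>The two sides lie in \<open>K j\<close> and are compared by the injective
  \<open>u i j 1\<close>.\<close>

lemma K_u_h:
  assumes y: "y \<in> K i" and ij: "i \<noteq> j" shows "u j i a (h i j b y) = u j i (a * b) y"
proof -
  have ji: "j \<noteq> i" using ij by simp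
  have "u j i a (h i j b y) - u j i (a * b) y = 0"
  proof (rule K_inj[OF _ ij])
    show "u j i a (h i j b y) - u j i (a * b) y \<in> K j" by (intro K_closed K_step K_h y ji)
    show "u i j 1 (u j i a (h i j b y) - u j i (a * b) y) = 0"
      using ij K_up_down[OF y ij] K_up_down[OF K_h[OF y] ij] K_h_mult[OF y ij] by (simp add: u_arg)
  qed
  then show ?thesis by simp
qed

text \<open>On \<open>K i\<close> the operators \<open>h i j a\<close>, for fixed \<open>j\<close>, are a multiplication by complex scalars \<open>a\<close>; the
  line through \<open>y\<close> becomes the \<open>i\<close>-th coordinate axis of a copy of \<open>E\<close>.\<close>
definition e_map :: "3 \<Rightarrow> 3 \<Rightarrow> 3 \<Rightarrow> 'a \<Rightarrow> complex^3 \<Rightarrow> 'a" where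
  "e_map i j k y x = h i j (x $ i) y + u j i (x $ j) y + u k i (x $ k) y"

lemma h_coeff_scaleR: "h i j (r *\<^sub>R a) v = r *\<^sub>R h i j a v"
  using h_coeff(2)[of i j r a v] by (simp add: scaleR_conv_of_real)

lemma u_coeff_scaleR: "i \<noteq> j \<Longrightarrow> u i j (r *\<^sub>R a) v = r *\<^sub>R u i j a v"
  using u_coeff(2)[of i j r a v] by (simp add: scaleR_conv_of_real)

lemma linear_e_map:
  assumes "distinct [i, j, k]" shows "linear (e_map i j k y)"
  using distinct_3D[OF assms]
  by (intro linearI) (simp_all add: e_map_def h_coeff u_coeff h_coeff_scaleR u_coeff_scaleR algebra_simps)

text \<open>Exchanging j and k lets the three matrix units of the next lemma stand for all
  six.\<close>

lemma e_map_swap: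
  "y \<in> K i \<Longrightarrow> distinct [i, j, k] \<Longrightarrow> e_map i k j y x = e_map i j k y x"
  by (simp add: e_map_def K_h_third[of y i j k])

lemma h_zero_coeff [simp]: "h i j 0 v = 0"
  using h_coeff(2)[of i j 0 0 v] by simp

lemma e_map_mat_unit:
  assumes y: "y \<in> K i" and d: "distinct [i, j, k]"
  shows "e_map i j k y (mat_unit i j a *v x) = u i j a (e_map i j k y x)"
    and "e_map i j k y (mat_unit j i a *v x) = u j i a (e_map i j k y x)"
    and "e_map i j k y (mat_unit j k a *v x) = u j k a (e_map i j k y x)"
proof -
  note n = distinct_3D[OF d]
  have hK: "h i j b y \<in> K i" for b by (rule K_h[OF y])
  have a1: "u i j a (h i j b y) = 0" for b using K_up[OF hK] n by blast
  have a2: "u i j a (u j i b y) = h i j (a * b) y" for b using K_up_down[OF y] n by blast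
  have a3: "u i j a (u k i b y) = 0" for b
    using u_u_chain'[of i j k a b y] K_up[OF y, of j a] K_kill[OF y, of k j] n by (simp add: u_arg)
  show "e_map i j k y (mat_unit i j a *v x) = u i j a (e_map i j k y x)"
    using n by (simp add: e_map_def mat_unit_vector_nth u_arg u_coeff a1 a2 a3)
  have b1: "u j i a (h i j b y) = u j i (a * b) y" for b using K_u_h[OF y] n by blast
  have step: "u p i b y \<in> K p" if "p \<noteq> i" for p b using K_step[OF y that] .
  have b2: "u j i a (u j i b y) = 0" for b using K_up[OF step] n by blast
  have b3: "u j i a (u k i b y) = 0" for b using K_kill[OF step[of k]] n by auto
  show "e_map i j k y (mat_unit j i a *v x) = u j i a (e_map i j k y x)"
    using n by (simp add: e_map_def mat_unit_vector_nth u_arg u_coeff b1 b2 b3)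
  have c1: "u j k a (h i j b y) = 0" for b using K_kill[OF hK] n by auto
  have c2: "u j k a (u j i b y) = 0" for b using K_up[OF step] n by blast
  have c3: "u j k a (u k i b y) = u j i (a * b) y" for b
    using u_u_chain[of j k i a b y] K_kill[OF y, of j k] n by (simp add: u_arg)
  show "e_map i j k y (mat_unit j k a *v x) = u j k a (e_map i j k y x)"
    using n by (simp add: e_map_def mat_unit_vector_nth u_arg u_coeff c1 c2 c3)
qed

lemma e_map_equivariant:
  assumes y: "y \<in> K i" and d: "distinct [i, j, k]" and X: "X \<in> sl3"
  shows "e_map i j k y (X *v x) = \<rho> X (e_map i j k y x)"
proof -
  have lin: "linear (e_map i j k y)" by (rule linear_e_map[OF d])
  from X have "\<forall>x. e_map i j k y (X *v x) = \<rho> X (e_map i j k y x)"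
  proof (induction X rule: sl3_induct)
    case (mat_unit p q a)
    have d': "distinct [i, k, j]" using d by auto
    note E = e_map_mat_unit[OF y d] e_map_mat_unit[OF y d', unfolded e_map_swap[OF y d]]
    show ?case
      using exhaust_distinct_3[OF d, of p] exhaust_distinct_3[OF d, of q] mat_unit E
      by (elim disjE) (simp_all add: u_def)
  next
    case (add X Y)
    then show ?case by (simp add: matrix_vector_mult_add_rdistrib linear_add[OF lin] rho_plus)
  next
    case (bracket X Y)
    have "lie_bracket X Y *v x = X *v (Y *v x) - Y *v (X *v x)" for x
      by (simp add: lie_bracket_def matrix_vector_mult_diff_rdistrib matrix_vector_mul_assoc)
    then show ?case using bracket by (simp add: linear_diff[OF lin] rho_bracket)
  qed
  then show ?thesis by blast
qed

end

section \<open>The embedding of Her and its complement\<close>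

locale sl3_her_frame = sl3_her +
  fixes w :: "3 \<Rightarrow> 'a"
  assumes w_N: "w i \<in> N i" and w_nz: "w i \<noteq> 0"
    and w_square: "i \<noteq> j \<Longrightarrow> u i j 1 (u i j 1 (w i)) = 2 *\<^sub>R w j"
    and w_sym: "i \<noteq> j \<Longrightarrow> u i j a (w i) = u j i (cnj a) (w j)"
begin

lemma w_kill: "l \<noteq> i \<Longrightarrow> l \<noteq> m \<Longrightarrow> u l m a (w i) = 0"
  by (rule N_kill[OF w_N])

lemma u_u_w: "i \<noteq> j \<Longrightarrow> u i j a (u i j b (w i)) = (2 * Re (a * cnj b)) *\<^sub>R w j"
  by (subst N_relations(2)[OF w_N]) (simp_all add: w_square)

lemma u_u_w':
  assumes "distinct [i, j, k]"
  shows "u i j a (u i k b (w i)) = - u k j (a * cnj b) (w k)"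
  using u_u_chain'[of i j k a "cnj b" "w k"] w_sym[of i k b] w_kill[of i k j a] distinct_3D[OF assms]
  by (simp add: u_arg)

lemma u_u_w0:
  assumes "distinct [i, j, k]" shows "u i j a (u j k b (w j)) = 0"
  using P_kill[OF N_P[OF w_N, of j k i], of j] distinct_3D[OF assms] by simp

text \<open>The form with entry \<open>z\<close> at \<open>(p, q)\<close> and \<open>cnj z\<close> at \<open>(q, p)\<close> is \<open>- (mat_unit p q z)\<close> applied to the diagonal
  form at \<open>p\<close>, but also the transposed expression; the factor 1/2 averages the two.\<close>
definition her_map :: "complex^3^3 \<Rightarrow> 'a" where
  "her_map H = (\<Sum>p\<in>UNIV. Re (H $ p $ p) *\<^sub>R w p)
    - (1/2) *\<^sub>R (\<Sum>p\<in>UNIV. \<Sum>q\<in>UNIV. if p = q then 0 else u p q (H $ p $ q) (w p))"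

lemma linear_her_map: "linear her_map"
proof (rule linearI)
  fix A B :: "complex^3^3" and r :: real
  have "(if p = q then 0 else u p q ((A + B) $ p $ q) (w p))
      = (if p = q then 0 else u p q (A $ p $ q) (w p)) + (if p = q then 0 else u p q (B $ p $ q) (w p))"
    for p q by (simp add: u_coeff)
  then show "her_map (A + B) = her_map A + her_map B"
    by (simp add: her_map_def sum.distrib algebra_simps)
  have "(if p = q then 0 else u p q ((r *\<^sub>R A) $ p $ q) (w p))
      = r *\<^sub>R (if p = q then 0 else u p q (A $ p $ q) (w p))" for p q
    by (simp add: u_coeff_scaleR)
  then show "her_map (r *\<^sub>R A) = r *\<^sub>R her_map A"
    by (simp add: her_map_def scaleR_sum_right scaleR_diff_right mult.commute)
qed

text \<open>For hermitian H, \<open>w_sym\<close> makes the two terms of each off-diagonal pair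
  equal, so the halves combine. The ordering i, j, k is free and can be adapted to the matrix unit
  that acts.\<close>

lemma her_map_eq:
  assumes H: "hermitian H" and d: "distinct [i, j, k]"
  shows "her_map H = Re (H $ i $ i) *\<^sub>R w i + Re (H $ j $ j) *\<^sub>R w j + Re (H $ k $ k) *\<^sub>R w k
    - (u i j (H $ i $ j) (w i) + u i k (H $ i $ k) (w i) + u j k (H $ j $ k) (w j))"
proof -
  note n = distinct_3D[OF d]
  have sym: "u q p (H $ q $ p) (w q) = u p q (H $ p $ q) (w p)" if "p \<noteq> q" for p q
    using w_sym[OF that, of "H $ p $ q"] hermitian_nth[OF H, of q p] by simp
  have "(\<Sum>p\<in>UNIV. \<Sum>q\<in>UNIV. if p = q then 0 else u p q (H $ p $ q) (w p))
      = 2 *\<^sub>R (u i j (H $ i $ j) (w i) + u i k (H $ i $ k) (w i) + u j k (H $ j $ k) (w j))"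
    using n sym[of i j] sym[of i k] sym[of j k] by (simp add: sum_distinct_3[OF d] scaleR_2 algebra_simps)
  then show ?thesis by (simp add: her_map_def sum_distinct_3[OF d])
qed

lemma her_map_equivariant:
  assumes "X \<in> sl3" "hermitian H"
  shows "her_map (her_action X H) = \<rho> X (her_map H)"
proof -
  note lin = linear_her_map
  from assms(1) have "\<forall>H. hermitian H \<longrightarrow> her_map (her_action X H) = \<rho> X (her_map H)"
  proof (induction X rule: sl3_induct)
    case (mat_unit i j a)
    obtain k where d: "distinct [i, j, k]" using ex_third[OF mat_unit] by blast
    note n = distinct_3D[OF d]
    show ?case
    proof (intro allI impI)
      fix H assume H: "hermitian H"
      let ?Z = "her_action (mat_unit i j a) H"
      define r where "r = 2 * Re (a * cnj (H $ i $ j))"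
      have Z: "?Z $ i $ i = 0" "?Z $ k $ k = 0" "?Z $ i $ k = 0" "?Z $ i $ j = - (H $ i $ i * a)"
        "?Z $ j $ k = - (cnj a * H $ i $ k)" "Re (?Z $ j $ j) = - r"
        using n hermitian_nth[OF H, of j i] by (simp_all add: r_def her_action_mat_unit_nth)
      have "her_map ?Z = - (r *\<^sub>R w j)
          + u i j (H $ i $ i * a) (w i) + u j k (cnj a * H $ i $ k) (w j)"
        using n by (simp add: her_map_eq[OF hermitian_her_action[OF H] d] Z u_coeff)
      also have "u i j (H $ i $ i * a) (w i) = Re (H $ i $ i) *\<^sub>R u i j a (w i)"
        using n hermitian_diag[OF H, of i] u_coeff(2)[of i j "Re (H $ i $ i)" a "w i"] by metis
      also have "u j k (cnj a * H $ i $ k) (w j) = u k j (a * cnj (H $ i $ k)) (w k)"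
        using w_sym[of j k "cnj a * H $ i $ k"] n by simp
      also have "- (r *\<^sub>R w j) + Re (H $ i $ i) *\<^sub>R u i j a (w i)
          + u k j (a * cnj (H $ i $ k)) (w k) = u i j a (her_map H)"
        using n by (simp add: r_def her_map_eq[OF H d] u_arg w_kill u_u_w u_u_w'[OF d] u_u_w0[OF d])
      finally show "her_map ?Z = \<rho> (mat_unit i j a) (her_map H)" by (simp add: u_def)
    qed
  next
    case (add X Y)
    then show ?case by (simp add: her_action_add linear_add[OF lin] rho_plus)
  next
    case (bracket X Y)
    then show ?case
      by (simp add: her_action_bracket linear_diff[OF lin] rho_bracket hermitian_her_action)
  qed
  then show ?thesis using assms(2) by blast
qed

lemma weight_components_zero:
  assumes d: "distinct [i, j, k]" and n: "\<And>p. n p \<in> N p" and x: "\<And>p. x p \<in> P p" and z: "z \<in> Z"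
    and sum: "n i + n j + n k + x i + x j + x k + z = 0"
  shows "n i = 0" "n j = 0" "n k = 0" "x i = 0" "x j = 0" "x k = 0" "z = 0"
proof -
  \<comment> \<open>The coefficient 5 separates the seven weights: T takes the values 1, 4, -5 on
    the eps, their multiples by -2 on the -2 eps, and 0.\<close>
  define T where "T v = h i j 1 v + 5 *\<^sub>R h j k 1 v" for v
  have lin: "linear T" by (rule linearI) (simp_all add: T_def algebra_simps)
  define f where "f l = (if l = -2 then n i else if l = -8 then n j else if l = 10 then n k
    else if l = 1 then x i else if l = 4 then x j else if l = -5 then x k else z)" for l :: real
  let ?A = "{-2, -8, 10, 1, 4, -5, 0 :: real}"
  note dd = distinct_3D[OF d]
  have Tw: "T v = of_int ((c i - c j) + 5 * (c j - c k)) *\<^sub>R v" if "v \<in> Wt c" for v c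
    by (simp add: T_def Wt_h[OF that] flip: scaleR_add_left)
  have "T (f l) = l *\<^sub>R f l" if "l \<in> ?A" for l
    using that Tw[OF n, of i] Tw[OF n, of j] Tw[OF n, of k] Tw[OF x, of i] Tw[OF x, of j]
      Tw[OF x, of k] Tw[OF z] dd
    by (auto simp: f_def single_def)
  moreover have "(\<Sum>l\<in>?A. f l) = 0" using sum by (simp add: f_def add.assoc)
  ultimately have "f l = 0" if "l \<in> ?A" for l
    using eigenvectors_sum_zero[OF lin, of ?A f l] that by blast
  from this[of "-2"] this[of "-8"] this[of 10] this[of 1] this[of 4] this[of "-5"] this[of 0]
  show "n i = 0" "n j = 0" "n k = 0" "x i = 0" "x j = 0" "x k = 0" "z = 0"
    by (simp_all add: f_def)
qed

lemma P_decompose: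
  assumes x: "x \<in> P k" and d: "distinct [i, j, k]"
  shows "\<exists>b. \<exists>y\<in>K k. x = y - u i j b (w i)"
proof -
  note n = distinct_3D[OF d]
  have ij: "i \<noteq> j" using n by simp
  obtain \<alpha> where \<alpha>: "u i j 1 x = \<alpha> *\<^sub>R w j" using N_multiple[OF w_N w_nz P_N[OF x d]] by blast
  obtain \<beta> where \<beta>: "u i j \<i> x = \<beta> *\<^sub>R w j" using N_multiple[OF w_N w_nz P_N[OF x d]] by blast
  \<comment> \<open>\<open>u i j a\<close> sends \<open>u i j b (w i)\<close> to 2 Re(a cnj b)
    \<open>w j\<close>, which is 2 Re b for a = 1 and 2 Im b for a = \<open>\<i>\<close>. This b
    cancels \<alpha> and \<beta>.\<close>
  define b where "b = Complex (- \<alpha> / 2) (- \<beta> / 2)"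
  define y where "y = x + u i j b (w i)"
  have yP: "y \<in> P k" unfolding y_def by (intro Wt_closed x N_P[OF w_N d])
  have ij0: "u i j a y = 0" for a
  proof -
    have "u i j 1 y = 0" "u i j \<i> y = 0"
      by (simp_all add: y_def u_arg[OF ij] u_u_w[OF ij] \<alpha> \<beta> b_def flip: scaleR_add_left)
    then show ?thesis by (subst u_split[OF ij]) simp
  qed
  have ji0: "u j i a y = 0" for a
  proof (cases "a = 0")
    case True
    then show ?thesis using n by (simp add: u_coeff)
  next
    case False
    show ?thesis
    proof (rule N_inj[of _ i j "inverse a"])
      show "u j i a y \<in> N i" by (rule P_N[OF yP]) (use n in auto)
      have "h i j 1 y = 0" using Wt_h[OF yP, of i j] n by (simp add: single_def)
      then show "u i j (inverse a) (u j i a y) = 0"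
        using u_u_opposite[OF ij, of "inverse a" a y] ij0 n False by (simp add: u_arg)
    qed (use n False in auto)
  qed
  have "u p q a y = 0" if "distinct [p, q, k]" for p q a
    using exhaust_distinct_3[OF d, of p] exhaust_distinct_3[OF d, of q] that ij0 ji0 by auto
  then have "y \<in> K k" using yP by (simp add: K_def)
  then show ?thesis by (intro exI[of _ b] bexI[of _ y]) (simp_all add: y_def)
qed

text \<open>Applying \<open>u i j b\<close> kills y and turns the other term into 2 |b|^2
  \<open>w j\<close>, so positivity makes the decomposition direct.\<close>

lemma K_component_zero:
  assumes y: "y \<in> K k" and d: "distinct [i, j, k]" and zero: "y - u i j b (w i) = 0"
  shows "b = 0" "y = 0"
proof -
  have ij: "i \<noteq> j" using d by simp
  have "u i j b (y - u i j b (w i)) = 0" unfolding zero by (simp add: u_arg[OF ij])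
  then have "(2 * Re (b * cnj b)) *\<^sub>R w j = 0"
    using K_kill[OF y d] by (simp add: u_arg[OF ij] u_u_w[OF ij])
  then show "b = 0" using w_nz[of j] by (simp add: complex_norm_square[symmetric] del: times_complex.simps)
  then show "y = 0" using zero by (simp add: u_coeff[OF ij])
qed

lemma K_sum: "(\<And>m. m < n \<Longrightarrow> f m \<in> K k) \<Longrightarrow> (\<Sum>m<(n::nat). f m) \<in> K k"
  by (induction n) (auto simp: K_closed)

lemma her_map_diagonal:
  "hermitian (mat_unit p p (of_real r)) \<and> her_map (mat_unit p p (of_real r)) = r *\<^sub>R w p"
proof -
  obtain q l where d: "distinct [p, q, l]" using ex_distinct_3 by blast
  have H: "hermitian (mat_unit p p (of_real r))" by (simp add: hermitian_def adj_mat_mat_unit)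
  then show ?thesis
    using distinct_3D[OF d] by (simp add: her_map_eq[OF H d] mat_unit_nth u_coeff)
qed

lemma her_map_off_diagonal:
  assumes d: "distinct [p, q, l]"
  shows "hermitian (mat_unit p q b + mat_unit q p (cnj b)) \<and>
    her_map (mat_unit p q b + mat_unit q p (cnj b)) = - u p q b (w p)"
proof -
  have H: "hermitian (mat_unit p q b + mat_unit q p (cnj b))"
    by (simp add: hermitian_def adj_mat_mat_unit adj_mat_add)
  then show ?thesis
    using distinct_3D[OF d] by (simp add: her_map_eq[OF H d] mat_unit_nth u_coeff)
qed

section \<open>Assembling the isomorphism\<close>

lemma rep_iso_frame: "\<exists>k m. rep_iso_model \<rho> k 0 m"
proof -
  obtain i j k :: 3 where d: "distinct [i, j, k]" using ex_distinct_3 by blast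
  note n = distinct_3D[OF d]
  have ij: "i \<noteq> j" using n by simp
  have "\<exists>(n::nat) v. (\<forall>m<n. v m \<in> K i) \<and> (\<forall>a. (\<Sum>m<n. h i j (a m) (v m)) = 0 \<longrightarrow> (\<forall>m<n. a m = 0))
    \<and> (\<forall>y\<in>K i. \<exists>a. y = (\<Sum>m<n. h i j (a m) (v m)))"
    using h_coeff(2)[of i j _ 1] K_h_1[OF _ ij]
    by (intro exists_module_basis) (simp_all add: K_closed K_h K_h_mult[OF _ ij])
  then obtain nv :: nat and v where "(\<forall>m<nv. v m \<in> K i)
    \<and> (\<forall>a. (\<Sum>m<nv. h i j (a m) (v m)) = 0 \<longrightarrow> (\<forall>m<nv. a m = 0))
    \<and> (\<forall>y\<in>K i. \<exists>a. y = (\<Sum>m<nv. h i j (a m) (v m)))" by (elim exE)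
  then have v: "\<And>m. m < nv \<Longrightarrow> v m \<in> K i"
    "\<And>a. (\<Sum>m<nv. h i j (a m) (v m)) = 0 \<Longrightarrow> \<forall>m<nv. a m = 0"
    "\<And>y. y \<in> K i \<Longrightarrow> \<exists>a. y = (\<Sum>m<nv. h i j (a m) (v m))" by simp_all
  have "\<exists>(n::nat) t. (\<forall>m<n. t m \<in> Z) \<and> (\<forall>a. (\<Sum>m<n. a m *\<^sub>R t m) = 0 \<longrightarrow> (\<forall>m<n. a m = 0))
    \<and> (\<forall>y\<in>Z. \<exists>a. y = (\<Sum>m<n. a m *\<^sub>R t m))"
    by (intro exists_module_basis) (simp_all add: Wt_closed scaleR_add_right)
  then obtain nt :: nat and t where "(\<forall>m<nt. t m \<in> Z)
    \<and> (\<forall>a. (\<Sum>m<nt. a m *\<^sub>R t m) = 0 \<longrightarrow> (\<forall>m<nt. a m = 0))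
    \<and> (\<forall>y\<in>Z. \<exists>a. y = (\<Sum>m<nt. a m *\<^sub>R t m))" by (elim exE)
  then have t: "\<And>m. m < nt \<Longrightarrow> t m \<in> Z"
    "\<And>a. (\<Sum>m<nt. a m *\<^sub>R t m) = 0 \<Longrightarrow> \<forall>m<nt. a m = 0"
    "\<And>y. y \<in> Z \<Longrightarrow> \<exists>a. y = (\<Sum>m<nt. a m *\<^sub>R t m)" by simp_all
  define e where "e m = e_map i j k (v m)" for m
  have lin_e: "linear (e m)" for m unfolding e_def by (rule linear_e_map[OF d])
  define \<Phi> where "\<Phi> H x c = her_map H + (\<Sum>m<nv. e m (x m)) + (\<Sum>m<nt. c m *\<^sub>R t m)" for H x c
  have \<Phi>_add: "\<Phi> (H + H') (\<lambda>m. x m + x' m) (\<lambda>m. c m + c' m) = \<Phi> H x c + \<Phi> H' x' c'" for H H' x x' c c'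
    by (simp add: \<Phi>_def linear_add[OF linear_her_map] linear_add[OF lin_e] sum.distrib scaleR_add_left)
  have \<Phi>_diff: "\<Phi> (H - H') (\<lambda>m. x m - x' m) (\<lambda>m. c m - c' m) = \<Phi> H x c - \<Phi> H' x' c'" for H H' x x' c c'
    using \<Phi>_add[of "H - H'" H' "\<lambda>m. x m - x' m" x' "\<lambda>m. c m - c' m" c'] by simp
  have e_sum: "(\<Sum>m<nv. e m (x m)) = (\<Sum>m<nv. h i j (x m $ i) (v m)) + (\<Sum>m<nv. u j i (x m $ j) (v m))
      + (\<Sum>m<nv. u k i (x m $ k) (v m))" for x
    by (simp add: e_def e_map_def sum.distrib)
  \<comment> \<open>Moves the coordinates at j and k to the axis i, where the independence of v is
    available.\<close>
  have up: "u i l 1 (\<Sum>m<nv. u l i (a m) (v m)) = (\<Sum>m<nv. h i j (a m) (v m))" if l: "l = j \<or> l = k" for a l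
  proof -
    have il: "i \<noteq> l" using l n by auto
    have "u i l 1 (\<Sum>m<nv. u l i (a m) (v m)) = (\<Sum>m<nv. u i l 1 (u l i (a m) (v m)))"
      by (rule linear_sum[OF linear_u[OF il]])
    also have "\<dots> = (\<Sum>m<nv. h i j (a m) (v m))"
      using l by (intro sum.cong refl) (auto simp: K_up_down[OF v(1) il] K_h_third[OF v(1) d])
    finally show ?thesis .
  qed
  have zero: "H = 0 \<and> (\<forall>m<nv. x m = 0) \<and> (\<forall>m<nt. c m = 0)"
    if H: "hermitian H" and \<Phi>0: "\<Phi> H x c = 0" for H x c
  proof -
    let ?yi = "\<Sum>m<nv. h i j (x m $ i) (v m)"
    let ?yl = "\<lambda>l. \<Sum>m<nv. u l i (x m $ l) (v m)"
    \<comment> \<open>The component of weight eps_p: the p-th coordinates of the copies of E, minus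
      the contribution of the off-diagonal entry of H outside row and column p.\<close>
    define X where "X p = (if p = i then ?yi - u j k (H $ j $ k) (w j)
        else if p = j then ?yl j - u i k (H $ i $ k) (w i) else ?yl k - u i j (H $ i $ j) (w i))" for p
    have yi: "?yi \<in> K i" by (intro K_sum K_h v(1))
    have yl: "?yl l \<in> K l" if "l \<noteq> i" for l by (intro K_sum K_step v(1) that)
    have dj: "distinct [j, k, i]" "distinct [i, k, j]" using d by auto
    have XP: "X p \<in> P p" for p
      using exhaust_distinct_3[OF d, of p] n K_P[OF yi] K_P[OF yl[of j]] K_P[OF yl[of k]]
        N_P[OF w_N d] N_P[OF w_N dj(1)] N_P[OF w_N dj(2)]
      by (elim disjE) (auto simp: X_def intro!: Wt_closed)
    have tZ: "(\<Sum>m<nt. c m *\<^sub>R t m) \<in> Z"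
      by (rule subspace_sum[OF subspace_Wt]) (auto intro: Wt_closed t(1))
    have "Re (H $ i $ i) *\<^sub>R w i + Re (H $ j $ j) *\<^sub>R w j + Re (H $ k $ k) *\<^sub>R w k + X i + X j + X k
        + (\<Sum>m<nt. c m *\<^sub>R t m) = 0"
      using \<Phi>0 n by (simp add: \<Phi>_def e_sum her_map_eq[OF H d] X_def algebra_simps)
    note comp = weight_components_zero[OF d Wt_closed(4)[OF w_N] XP tZ this]
    have Xi: "H $ j $ k = 0" "?yi = 0"
      using K_component_zero[OF yi dj(1)] comp(4) by (auto simp: X_def)
    have Xj: "H $ i $ k = 0" "?yl j = 0"
      using K_component_zero[OF yl[of j] dj(2)] comp(5) n by (auto simp: X_def)
    have Xk: "H $ i $ j = 0" "?yl k = 0"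
      using K_component_zero[OF yl[of k] d] comp(6) n by (auto simp: X_def)
    have diag: "H $ p $ p = 0" for p
      using exhaust_distinct_3[OF d, of p] comp(1-3) w_nz hermitian_diag[OF H, of p] by auto
    have "H $ p $ q = 0" for p q
      using exhaust_distinct_3[OF d, of p] exhaust_distinct_3[OF d, of q] diag Xi(1) Xj(1) Xk(1)
        hermitian_nth[OF H, of j i] hermitian_nth[OF H, of k i] hermitian_nth[OF H, of k j]
      by auto
    then have "H = 0" by (simp add: vec_eq_iff)
    moreover have "x m $ p = 0" if "m < nv" for m p
    proof -
      have "x m $ i = 0" using v(2)[OF Xi(2)] that by blast
      moreover have "x m $ j = 0"
        using v(2)[of "\<lambda>m. x m $ j"] up[of j "\<lambda>m. x m $ j"] Xj(2) that n by (simp add: u_arg)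
      moreover have "x m $ k = 0"
        using v(2)[of "\<lambda>m. x m $ k"] up[of k "\<lambda>m. x m $ k"] Xk(2) that n by (simp add: u_arg)
      ultimately show ?thesis using exhaust_distinct_3[OF d, of p] by auto
    qed
    moreover have "\<forall>m<nt. c m = 0" by (rule t(2)[OF comp(7)])
    ultimately show ?thesis by (simp add: vec_eq_iff)
  qed
  \<comment> \<open>The image of \<Phi> is closed under addition, so surjectivity reduces to weight
    vectors.\<close>
  define S where "S = {s. \<exists>H x c. hermitian H \<and> s = \<Phi> H x c}"
  have S_I: "\<Phi> H x c \<in> S" if "hermitian H" for H x c using that unfolding S_def by blast
  have S_add: "s + s' \<in> S" if "s \<in> S" "s' \<in> S" for s s'
  proof -
    obtain H x c where 1: "hermitian H \<and> s = \<Phi> H x c"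
      using \<open>s \<in> S\<close> unfolding S_def mem_Collect_eq by (elim exE)
    obtain H' x' c' where 2: "hermitian H' \<and> s' = \<Phi> H' x' c'"
      using \<open>s' \<in> S\<close> unfolding S_def mem_Collect_eq by (elim exE)
    have "hermitian (H + H')" using 1 2 by (simp add: hermitian_def adj_mat_add)
    from S_I[OF this, of "\<lambda>m. x m + x' m" "\<lambda>m. c m + c' m"] show ?thesis
      using 1 2 by (simp add: \<Phi>_add)
  qed
  have e0: "e m 0 = 0" for m by (rule linear_0[OF lin_e])
  have h0: "hermitian 0" by (simp add: hermitian_def adj_mat_def vec_eq_iff)
  have her0: "her_map 0 = 0" by (rule linear_0[OF linear_her_map])
  have S_her: "her_map H \<in> S" if "hermitian H" for H
    using S_I[OF that, of "\<lambda>_. 0" "\<lambda>_. 0"] by (simp add: \<Phi>_def e0)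
  have S_e: "(\<Sum>m<nv. e m (x m)) \<in> S" for x
    using S_I[OF h0, of x "\<lambda>_. 0"] by (simp add: \<Phi>_def her0)
  have S_t: "(\<Sum>m<nt. c m *\<^sub>R t m) \<in> S" for c
    using S_I[OF h0, of "\<lambda>_. 0" c] by (simp add: \<Phi>_def her0 e0)
  have S_Ki: "y \<in> S" if y: "y \<in> K i" for y
  proof -
    obtain a where a: "y = (\<Sum>m<nv. h i j (a m) (v m))" using v(3)[OF y] by (elim exE)
    then have "y = (\<Sum>m<nv. e m (axis i (a m)))"
      using n by (simp add: e_def e_map_def axis_def u_coeff)
    then show ?thesis using S_e by simp
  qed
  have S_Kl: "y \<in> S" if y: "y \<in> K l" and l: "l = j \<or> l = k" for y l
  proof -
    have il: "i \<noteq> l" "l \<noteq> i" using l n by auto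
    \<comment> \<open>y is expanded after transport to \<open>K i\<close>; \<open>K_down_up\<close>
      brings it back to \<open>K l\<close>.\<close>
    obtain a where a: "u i l 1 y = (\<Sum>m<nv. h i j (a m) (v m))" using v(3)[OF K_step[OF y il(1), of 1]] by (elim exE)
    have "y = u l i 1 (\<Sum>m<nv. h i j (a m) (v m))" using K_down_up[OF y il(1)] a by simp
    also have "\<dots> = (\<Sum>m<nv. u l i 1 (h i j (a m) (v m)))" by (rule linear_sum[OF linear_u[OF il(2)]])
    also have "\<dots> = (\<Sum>m<nv. u l i (a m) (v m))"
    proof (rule sum.cong[OF refl])
      fix m assume "m \<in> {..<nv}"
      then have vm: "v m \<in> K i" using v(1) by simp
      have "h i j (a m) (v m) = h i l (a m) (v m)" using l K_h_third[OF vm d] by auto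
      then show "u l i 1 (h i j (a m) (v m)) = u l i (a m) (v m)"
        using K_u_h[OF vm il(1), of 1 "a m"] by simp
    qed
    also have "\<dots> = (\<Sum>m<nv. e m (axis l (a m)))"
      using n l by (intro sum.cong refl) (auto simp: e_def e_map_def axis_def u_coeff)
    finally show ?thesis using S_e by simp
  qed
  have all: "s \<in> S" for s
  proof (induction s rule: Wt_induct)
    case (weight c s)
    show ?case
    proof (cases "s = 0")
      case True
      then show ?thesis using S_her[OF h0] her0 by simp
    next
      case False
      then have "is_weight c" using weight by (auto simp: is_weight_def)
      then obtain l m where lm: "m = 0 \<or> m = 1 \<or> m = -2" "\<And>x y. c x - c y = single l m x - single l m y"
        using weights by blast
      have s: "s \<in> Wt (single l m)" using weight lm(2) by (simp add: Wt_def)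
      from lm(1) show ?thesis
      proof (elim disjE)
        assume "m = 0"
        then have "s \<in> Z" using s by (simp add: single_def)
        then obtain a where "s = (\<Sum>m<nt. a m *\<^sub>R t m)" using t(3)[OF \<open>s \<in> Z\<close>] by (elim exE)
        then show ?thesis using S_t by simp
      next
        assume "m = -2"
        then obtain r where "s = r *\<^sub>R w l" using N_multiple[OF w_N w_nz] s by blast
        then show ?thesis using S_her her_map_diagonal by metis
      next
        assume "m = 1"
        then have sP: "s \<in> P l" using s by simp
        obtain p q where pq: "distinct [p, q, l]"
          using ex_distinct_3[of l] by (metis distinct_length_2_or_more distinct_singleton)
        obtain b y where y: "y \<in> K l" "s = y - u p q b (w p)" using P_decompose[OF sP pq] by blast
        have "y \<in> S" using exhaust_distinct_3[OF d, of l] y(1) S_Ki S_Kl by auto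
        moreover have "- u p q b (w p) \<in> S" using S_her her_map_off_diagonal[OF pq] by metis
        ultimately show ?thesis using S_add y(2) by fastforce
      qed
    qed
  qed (rule S_add)
  have F: "(\<lambda>(H, x, y, c). her_map H + (\<Sum>m<nv. e m (x m)) + (\<Sum>m<(0::nat). (\<lambda>_ _. 0) m (y m)) + (\<Sum>m<nt. c m *\<^sub>R t m))
      = (\<lambda>(H, x, y :: nat \<Rightarrow> complex^3, c). \<Phi> H x c)"
    by (auto simp: \<Phi>_def)
  have inj: "inj_on (\<lambda>(H, x, y, c). \<Phi> H x c) (model nv 0 nt)"
  proof (rule inj_onI)
    fix X X'
    assume X: "X \<in> model nv 0 nt" "X' \<in> model nv 0 nt"
      and \<Phi>X: "(\<lambda>(H, x, y, c). \<Phi> H x c) X = (\<lambda>(H, x, y, c). \<Phi> H x c) X'"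
    obtain H x y c where X1: "X = (H, x, y, c)" by (cases X)
    obtain H' x' y' c' where X2: "X' = (H', x', y', c')" by (cases X')
    note m = X[unfolded X1 X2] and eq = \<Phi>X[unfolded X1 X2 prod.case]
    have "hermitian (H - H')" using m by (simp add: model_def hermitian_def adj_mat_diff)
    then have z: "H - H' = 0 \<and> (\<forall>m<nv. x m - x' m = 0) \<and> (\<forall>m<nt. c m - c' m = 0)"
      by (rule zero) (simp add: \<Phi>_diff eq)
    have "x m = x' m" for m using z m by (cases "m < nv") (auto simp: model_def)
    moreover have "c m = c' m" for m using z m by (cases "m < nt") (auto simp: model_def)
    moreover have "y = y'" using m by (auto simp: model_def)
    ultimately show "X = X'" using z by (auto simp: X1 X2)
  qed
  have surj: "(\<lambda>(H, x, y, c). \<Phi> H x c) ` model nv 0 nt = UNIV"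
  proof (rule UNIV_eq_I[symmetric])
    fix s
    obtain H x c where s: "hermitian H \<and> s = \<Phi> H x c"
      using all[of s] unfolding S_def mem_Collect_eq by (elim exE)
    \<comment> \<open>\<open>model\<close> demands zeros beyond the range, while \<Phi> reads only
      the first nv and nt entries.\<close>
    let ?x = "\<lambda>m. if m < nv then x m else 0" and ?c = "\<lambda>m. if m < nt then c m else 0"
    have "\<Phi> H x c = \<Phi> H ?x ?c" by (simp add: \<Phi>_def)
    then show "s \<in> (\<lambda>(H, x, y, c). \<Phi> H x c) ` model nv 0 nt"
      using s by (intro image_eqI[of _ _ "(H, ?x, \<lambda>_. 0, ?c)"]) (auto simp: model_def)
  qed
  have "rep_iso_model \<rho> nv 0 nt"
    unfolding rep_iso_model_def
  proof (rule exI[of _ her_map], rule exI[of _ e], rule exI[of _ "\<lambda>_ _. 0"], rule exI[of _ t],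
      intro conjI)
    show "linear her_map" by (rule linear_her_map)
    show "\<forall>m<nv. linear (e m)" using lin_e by blast
    show "\<forall>X\<in>sl3. \<forall>H. hermitian H \<longrightarrow> her_map (her_action X H) = \<rho> X (her_map H)"
      using her_map_equivariant by blast
    show "\<forall>X\<in>sl3. \<forall>m<nv. \<forall>x. e m (X *v x) = \<rho> X (e m x)"
      unfolding e_def using e_map_equivariant[OF v(1) d] by blast
    show "\<forall>X\<in>sl3. \<forall>m<nt. \<rho> X (t m) = 0"
    proof (intro ballI allI impI)
      fix X m assume "X \<in> sl3" "m < nt"
      from this(1) show "\<rho> X (t m) = 0"
      proof (induction X rule: sl3_induct)
        case (mat_unit p q a)
        then show ?case using Z_kill[OF t(1)[OF \<open>m < nt\<close>]] by (simp add: u_def)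
      next
        case (bracket X Y)
        then show ?case using rho_linear by (simp add: rho_bracket linear_0)
      qed (simp add: rho_plus)
    qed
    show "bij_betw (\<lambda>(H, x, y, c). her_map H + (\<Sum>m<nv. e m (x m)) + (\<Sum>m<0. (\<lambda>_ _. 0) m (y m))
        + (\<Sum>m<nt. c m *\<^sub>R t m)) (model nv 0 nt) UNIV"
      unfolding F bij_betw_def using inj surj by blast
  qed simp_all
  then show ?thesis by blast
qed

end

lemma (in sl3_her) rep_iso: "\<exists>k m. rep_iso_model \<rho> k 0 m"
proof -
  obtain w where "(\<forall>i. w i \<in> N i \<and> w i \<noteq> 0)
    \<and> (\<forall>i j. i \<noteq> j \<longrightarrow> u i j 1 (u i j 1 (w i)) = 2 *\<^sub>R w j)
    \<and> (\<forall>i j a. i \<noteq> j \<longrightarrow> u i j a (w i) = u j i (cnj a) (w j))"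
    using exists_her_frame by (elim exE)
  then have w: "\<forall>i. w i \<in> N i \<and> w i \<noteq> 0"
    "\<forall>i j. i \<noteq> j \<longrightarrow> u i j 1 (u i j 1 (w i)) = 2 *\<^sub>R w j"
    "\<forall>i j a. i \<noteq> j \<longrightarrow> u i j a (w i) = u j i (cnj a) (w j)"
    by - (elim conjE, assumption)+
  interpret sl3_her_frame \<rho> w
  proof unfold_locales
    show "w i \<in> N i" "w i \<noteq> 0" for i using w(1) by simp_all
  qed (fact w(2)[rule_format], fact w(3)[rule_format])
  show ?thesis by (rule rep_iso_frame)
qed

sublocale sl3_wedge_neg \<subseteq> sl3_her
  by unfold_locales (fact weights, fact weight_neg2, fact neg2_one_dim)

section \<open>The automorphism that negates the weights\<close>

definition neg_transpose :: "complex^3^3 \<Rightarrow> complex^3^3" where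
  "neg_transpose X = - transpose X"

lemma neg_transpose_involution: "neg_transpose (neg_transpose X) = X"
  by (simp add: neg_transpose_def vec_eq_iff transpose_def)

lemma neg_transpose_sl3 [simp]: "neg_transpose X \<in> sl3 \<longleftrightarrow> X \<in> sl3"
  by (simp add: neg_transpose_def sl3_def trace_def transpose_def sum_negf)

lemma neg_transpose_add: "neg_transpose (X + Y) = neg_transpose X + neg_transpose Y"
  by (simp add: neg_transpose_def vec_eq_iff transpose_def)

lemma neg_transpose_scale: "neg_transpose (r *\<^sub>R X) = r *\<^sub>R neg_transpose X"
  by (simp add: neg_transpose_def vec_eq_iff transpose_def)

lemma neg_transpose_bracket:
  "neg_transpose (lie_bracket X Y) = lie_bracket (neg_transpose X) (neg_transpose Y)"
  by (simp add: neg_transpose_def lie_bracket_def vec_eq_iff transpose_def matrix_matrix_mult_def mult.commute)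

lemma neg_transpose_coroot: "neg_transpose (coroot i j a) = - coroot i j a"
  by (auto simp: neg_transpose_def coroot_def vec_eq_iff transpose_def mat_unit_nth)

lemma is_lie_aut_neg_transpose: "is_lie_aut neg_transpose"
proof -
  have "bij_betw neg_transpose sl3 sl3"
    by (rule bij_betw_byWitness[where f' = neg_transpose]) (auto simp: neg_transpose_involution)
  then show ?thesis
    by (simp add: is_lie_aut_def neg_transpose_add neg_transpose_scale neg_transpose_bracket)
qed

lemma is_lie_aut_id: "is_lie_aut (\<lambda>X. X)"
  by (simp add: is_lie_aut_def bij_betw_def)

text \<open>The same wedge serves: equivariance quantifies over all of \<open>sl3\<close>, which
  \<open>neg_transpose\<close> permutes.\<close>

lemma (in sl3_wedge) sl3_wedge_dual: "sl3_wedge (\<lambda>X. \<rho> (neg_transpose X)) wedge"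
proof unfold_locales
  show "is_real_rep (\<lambda>X. \<rho> (neg_transpose X))"
    by (simp add: is_real_rep_def neg_transpose_add neg_transpose_scale neg_transpose_bracket
        rho_linear rho_plus rho_scale rho_bracket)
  show "inj_on (\<lambda>X. \<rho> (neg_transpose X)) sl3"
    by (rule inj_onI) (metis faithful inj_onD neg_transpose_involution neg_transpose_sl3)
  show "\<forall>X\<in>sl3. \<forall>a b z. - wedge a b (\<rho> (neg_transpose X) z)
      = wedge (\<rho> (neg_transpose X) a) b z + wedge a (\<rho> (neg_transpose X) b) z"
    using wedge_equivariant by simp
qed (use wedge_bilinear wedge_dual wedge_sym wedge_nondeg in auto)

theorem theorem5p6:
  fixes \<rho> :: "complex^3^3 \<Rightarrow> 'w::euclidean_space \<Rightarrow> 'w"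
    and wedge :: "'w \<Rightarrow> 'w \<Rightarrow> 'w \<Rightarrow> real"
  assumes rep: "is_real_rep \<rho>"
    and faithful: "inj_on \<rho> sl3"
    and wedge_bilinear: "\<forall>z. bilinear (\<lambda>a b. wedge a b z)"
    and wedge_dual: "\<forall>a b. linear (wedge a b)"
    and wedge_sym: "\<forall>a b. wedge a b = wedge b a"
    and wedge_equivariant: "\<forall>X\<in>sl3. \<forall>a b z.
          - wedge a b (\<rho> X z) = wedge (\<rho> X a) b z + wedge a (\<rho> X b) z"
    and wedge_nondeg: "\<forall>P. subspace P \<and> dim P = 2 \<longrightarrow>
          (\<exists>a\<in>P. \<exists>b\<in>P. wedge a b \<noteq> (\<lambda>_. 0))"
  shows "\<exists>\<phi> k l m. is_lie_aut \<phi> \<and> rep_iso_model (\<lambda>X. \<rho> (\<phi> X)) k l m"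
proof -
  interpret sl3_wedge \<rho> wedge
    by unfold_locales (fact assms)+
  obtain c where "top_weight c" using exists_top_weight[OF faithful] by blast
  then obtain i n where n: "n \<noteq> 0" "top_weight (single i n)" using top_weight_single by blast
  show ?thesis
  proof (cases "n < 0")
    case True
    then interpret sl3_wedge_neg \<rho> wedge i n by unfold_locales (use n in auto)
    show ?thesis using rep_iso is_lie_aut_id by blast
  next
    case False
    interpret dual: sl3_wedge "\<lambda>X. \<rho> (neg_transpose X)" wedge by (rule sl3_wedge_dual)
    have h: "dual.h p q 1 v = - h p q 1 v" for p q v
      by (simp add: dual.h_def h_def neg_transpose_coroot rho_minus)
    \<comment> \<open>The twisted representation has the negated weights with the same norms, so a
      top weight with n > 0 turns into one with -n < 0.\<close>
    have Wt: "dual.Wt c = Wt (\<lambda>x. - c x)" for c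
    proof -
      have "- h p q 1 v = of_int (c p - c q) *\<^sub>R v \<longleftrightarrow> h p q 1 v = of_int (- c p - - c q) *\<^sub>R v" for p q v
        by (subst neg_equal_iff_equal[symmetric]) (simp flip: scaleR_minus_left)
      then show ?thesis unfolding dual.Wt_def Wt_def h by simp
    qed
    have isw: "dual.is_weight c \<longleftrightarrow> is_weight (\<lambda>x. - c x)" for c
      by (simp add: dual.is_weight_def is_weight_def Wt)
    have wn: "wnorm (\<lambda>x. - c x) = wnorm c" for c using wnorm_scale[of "-1" c] by simp
    have "(\<lambda>x. - single i (- n) x) = single i n" by (auto simp: single_def)
    then have "dual.top_weight (single i (- n))"
      using n(2) wn[of "single i (- n)"] wn
      unfolding dual.top_weight_def top_weight_def isw by metis
    then interpret dual_neg: sl3_wedge_neg "\<lambda>X. \<rho> (neg_transpose X)" wedge i "- n"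
      by unfold_locales (use False n in auto)
    show ?thesis using dual_neg.rep_iso is_lie_aut_neg_transpose by blast
  qed
qed

end
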